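(* Let $k\ge 1$ and $N\ge 0$ be integers, let $c_1,\dots,c_N,b_1,\dots,b_N$ be positive real numbers and let $t\ge 0$ be a real number (with $0^0=1$). The following randomized algorithm outputs a $k$-tiling of the rank-$N$ Aztec diamond, and each $k$-tiling $\boldsymbol T$ is output with probability proportional to its weight $$\mathrm{wt}(\boldsymbol T)=t^{\#\text{interactions}(\boldsymbol T)}\prod_{a=1}^k \mathrm{wt}(T^{(a)}).$$ Algorithm. Start with the (empty) $k$-tiling of the rank-$0$ Aztec diamond. For $T=1,\dots,N$, pass from a $k$-tiling of rank $T-1$ to a $k$-tiling of rank $T$ as follows. 1. For each color independently, perform the slide-and-destroy step of the usual domino shuffle. For each color this gives a partial tiling of the rank-$T$ Aztec diamond whose uncovered region is a disjoint union of $2\times 2$ blocks (the "creation blocks" of that color). 2. Fill in the creation blocks, one color after another, from the smallest color to the largest; all creation blocks of a color are filled before passing to the next color. Given the configuration so far, each creation block of color $l$ is filled, independently of the other creation blocks of color $l$, with a horizontal pair of dominoes with probability $$\frac{c_i\,b_{T-i+1}\,t^{\#_1(l)+\#_2(l)}}{1+c_i\,b_{T-i+1}\,t^{\#_1(l)+\#_2(l)}}$$ and with a vertical pair of dominoes otherwise, where $2i-1$ is the diagonal (in the rank-$T$ indexing) containing the lower-left square of the block. Here, for the given block: - $\#_1(l)$ is the number of colors $m>l$ such that either the block is a creation block of color $m$ as well, or in color $m$ the lower-left square of the block is covered by the vertical domino occupying the lower-left and upper-left squares of the block, or by the horizontal domino occupying the lower-left and lower-right squares of the block; - $\#_2(l)$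 is the number of colors $m<l$ such that in color $m$ the upper-right square of the block is covered by the horizontal domino occupying it and the square immediately to its right, or by the vertical domino occupying it and the square immediately above it. (For the smallest color $l=1$ one has $\#_2(1)=0$.) The output is the $k$-tiling obtained after the step $T=N$.
   Context: Rank-$T$ Aztec diamond: the union of the unit squares of $\mathbb Z^2$ contained in $\{|x|+|y|\le T+1\}$ (for $T=0$ it is empty). Squares are labelled by their centers $(i,j)\in(\mathbb Z+\tfrac12)^2$; the square $(i,j)$ lies on diagonal $j-i+T\in\{0,\dots,2T\}$. In rank $T$, a square is white if its diagonal is odd and gray if its diagonal is even (so the color of a fixed square of the plane depends on the parity of $T$). A domino is a $2\times1$ or $1\times2$ rectangle made of two adjacent squares; a tiling covers every square of the diamond exactly once. Weights of single tilings of rank $N$: a horizontal domino whose left square is on diagonal $2m-1$ has weight $c_m$; a horizontal domino whose left square is on diagonal $2m$ has weight $b_{N-m+1}$; vertical dominoes have weight $1$. The weight $\mathrm{wt}(T)$ of a tiling $T$ is the product of the weights of its dominoes. $k$-tilings: a $k$-tiling is a $k$-tuple $\boldsymbol T=(T^{(1)},\dots,T^{(k)})$ of domino tilings of the same Aztec diamond; $T^{(a)}$ is said to have color $a$, and colors are ordered $1<2<\dots<k$. Interactions: for a white square $s$ and a color $a$, let $d_a(s)\in\{N,E,S,W\}$ be the direction (north/up, east/right, south/down, west/left) from $s$ to the other (gray) square of the domino of $T^{(a)}$ covering $s$. An interaction is a triple $(a,b,s)$ with colors $a<b$ and a white square $s$ such that $$(d_a(s),d_b(s))\in\{(E,E),(E,W),(E,N),(N,W)\}.$$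 Types of dominoes (in a rank-$T$ diamond with its coloring): a horizontal domino is of type S if its left square is white and of type N if its left square is gray; a vertical domino is of type W if its bottom square is white and of type E if its bottom square is gray. Slide-and-destroy step from rank $T-1$ to rank $T$ (single color; types are determined by the rank-$(T-1)$ coloring, and both diamonds are centered at the origin): dominoes of type S, W, N, E slide one unit south, west, north, east respectively, and any two dominoes that cross each other's path as they slide are both deleted (that is, two dominoes forming a $2\times2$ block with a type S domino directly above a type N domino, or with a type E domino directly to the left of a type W domino). The remaining slid dominoes form a partial tiling of the rank-$T$ diamond, whose uncovered part is, in a unique way, a disjoint union of $2\times 2$ blocks; in the rank-$T$ coloring, the lower-left and upper-right squares of each such block are white (hence on odd diagonals). For $T=1$ the single creation block is the whole rank-$1$ diamond. *)

theory Defs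
  imports "HOL-Probability.Probability"
begin

section \<open>Squares, the Aztec diamond, dominoes\<close>

text \<open>
  A unit square is given by the integer coordinates \<open>(x, y)\<close> of its lower-left corner; its center
  is \<open>(x + 1/2, y + 1/2)\<close>.  Hence the diagonal \<open>j - i + n\<close> of the square with center \<open>(i, j)\<close>
  is \<open>y - x + n\<close>.
\<close>

type_synonym sq = "int \<times> int"

definition unit_square :: "sq \<Rightarrow> (real \<times> real) set" where
  "unit_square s = {of_int (fst s)..of_int (fst s) + 1} \<times> {of_int (snd s)..of_int (snd s) + 1}"

definition aztec :: "nat \<Rightarrow> sq set" where
  "aztec n = {s. unit_square s \<subseteq> {p. \<bar>fst p\<bar> + \<bar>snd p\<bar> \<le> real n + 1}}"

definition diag :: "nat \<Rightarrow> sq \<Rightarrow> int" where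
  "diag n s = snd s - fst s + int n"

abbreviation white :: "nat \<Rightarrow> sq \<Rightarrow> bool" where
  "white n s \<equiv> odd (diag n s)"

datatype dir = North | East | South | West

fun nbr :: "dir \<Rightarrow> sq \<Rightarrow> sq" where
  "nbr North (x, y) = (x, y + 1)"
| "nbr East (x, y) = (x + 1, y)"
| "nbr South (x, y) = (x, y - 1)"
| "nbr West (x, y) = (x - 1, y)"

text \<open>\<open>Hor s\<close> is the horizontal domino with left square \<open>s\<close>; \<open>Ver s\<close> is the vertical domino with
  bottom square \<open>s\<close>.\<close>

datatype domino = Hor sq | Ver sq

fun squares :: "domino \<Rightarrow> sq set" where
  "squares (Hor s) = {s, nbr East s}"
| "squares (Ver s) = {s, nbr North s}"

definition covered :: "domino set \<Rightarrow> sq set" where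
  "covered D = (\<Union>d\<in>D. squares d)"

definition tilings :: "nat \<Rightarrow> domino set set" where
  "tilings n = {D. covered D \<subseteq> aztec n \<and> (\<forall>s\<in>aztec n. \<exists>!d. d \<in> D \<and> s \<in> squares d)}"

text \<open>A \<open>k\<close>-tiling is a family of tilings indexed by the colors \<open>1, \<dots>, k\<close> (and \<open>undefined\<close>
  outside, so that each \<open>k\<close>-tuple is represented exactly once).\<close>

definition ktilings :: "nat \<Rightarrow> nat \<Rightarrow> (nat \<Rightarrow> domino set) set" where
  "ktilings k n = {1..k} \<rightarrow>\<^sub>E tilings n"

section \<open>Weights and interactions\<close>

text \<open>For a horizontal domino inside the rank-\<open>n\<close> diamond the left square lies on a diagonal
  \<open>1, \<dots>, 2 n\<close>, so the conversions to \<open>nat\<close> below never truncate and all indices lie in \<open>{1..n}\<close>.\<close>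

fun domino_weight :: "(nat \<Rightarrow> real) \<Rightarrow> (nat \<Rightarrow> real) \<Rightarrow> nat \<Rightarrow> domino \<Rightarrow> real" where
  "domino_weight b c n (Hor s) =
     (if odd (diag n s) then c (nat ((diag n s + 1) div 2))
      else b (n - nat (diag n s div 2) + 1))"
| "domino_weight b c n (Ver s) = 1"

definition tiling_weight :: "(nat \<Rightarrow> real) \<Rightarrow> (nat \<Rightarrow> real) \<Rightarrow> nat \<Rightarrow> domino set \<Rightarrow> real" where
  "tiling_weight b c n D = (\<Prod>d\<in>D. domino_weight b c n d)"

definition partner_dir :: "domino set \<Rightarrow> sq \<Rightarrow> dir" where
  "partner_dir D s = (THE v. \<exists>d\<in>D. squares d = {s, nbr v s})"

definition interactions :: "nat \<Rightarrow> nat \<Rightarrow> (nat \<Rightarrow> domino set) \<Rightarrow> (nat \<times> nat \<times> sq) set" where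
  "interactions k n T = {(p, q, s). p \<in> {1..k} \<and> q \<in> {1..k} \<and> p < q \<and> s \<in> aztec n \<and> white n s \<and>
     (partner_dir (T p) s, partner_dir (T q) s)
       \<in> {(East, East), (East, West), (East, North), (North, West)}}"

definition ktiling_weight ::
  "(nat \<Rightarrow> real) \<Rightarrow> (nat \<Rightarrow> real) \<Rightarrow> real \<Rightarrow> nat \<Rightarrow> nat \<Rightarrow> (nat \<Rightarrow> domino set) \<Rightarrow> real" where
  "ktiling_weight b c t k n T =
     t ^ card (interactions k n T) * (\<Prod>a\<in>{1..k}. tiling_weight b c n (T a))"

section \<open>Slide-and-destroy\<close>

text \<open>Throughout this section \<open>n\<close> is the rank before sliding.  A domino's type is identified with
  the direction in which it slides.\<close>

fun dtype :: "nat \<Rightarrow> domino \<Rightarrow> dir" where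
  "dtype n (Hor s) = (if white n s then South else North)"
| "dtype n (Ver s) = (if white n s then West else East)"

fun slide :: "nat \<Rightarrow> domino \<Rightarrow> domino" where
  "slide n (Hor s) = Hor (nbr (dtype n (Hor s)) s)"
| "slide n (Ver s) = Ver (nbr (dtype n (Ver s)) s)"

text \<open>A colliding pair: \<open>d\<close> is of type North directly below \<open>e\<close> of type South, or \<open>d\<close> is of type
  East directly to the left of \<open>e\<close> of type West.\<close>

definition collide :: "nat \<Rightarrow> domino \<Rightarrow> domino \<Rightarrow> bool" where
  "collide n d e \<longleftrightarrow>
     (\<exists>s. d = Hor s \<and> e = Hor (nbr North s) \<and> dtype n d = North \<and> dtype n e = South) \<or>
     (\<exists>s. d = Ver s \<and> e = Ver (nbr East s) \<and> dtype n d = East \<and> dtype n e = West)"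

definition slide_destroy :: "nat \<Rightarrow> domino set \<Rightarrow> domino set" where
  "slide_destroy n D = slide n ` {d \<in> D. \<not> (\<exists>e\<in>D. collide n d e \<or> collide n e d)}"

section \<open>Creation blocks and the randomized shuffle\<close>

text \<open>A \<open>2 \<times> 2\<close> block is given by its lower-left square.  The decomposition of a finite region into
  disjoint blocks is unique if it exists.\<close>

definition block :: "sq \<Rightarrow> sq set" where
  "block s = {s, nbr East s, nbr North s, nbr North (nbr East s)}"

definition creation_blocks :: "nat \<Rightarrow> domino set \<Rightarrow> sq set" where
  "creation_blocks n P =
     (THE B. disjoint_family_on block B \<and> (\<Union>s\<in>B. block s) = aztec n - covered P)"

text \<open>In the following definitions \<open>C\<close> is the current configuration of the filling step in rank \<open>n\<close>,
  where colors not yet filled carry a partial tiling.\<close>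

definition num1 :: "nat \<Rightarrow> nat \<Rightarrow> (nat \<Rightarrow> domino set) \<Rightarrow> nat \<Rightarrow> sq \<Rightarrow> nat" where
  "num1 k n C l s = card {m \<in> {1..k}. l < m \<and>
     (s \<in> creation_blocks n (C m) \<or> Ver s \<in> C m \<or> Hor s \<in> C m)}"

definition num2 :: "nat \<Rightarrow> (nat \<Rightarrow> domino set) \<Rightarrow> nat \<Rightarrow> sq \<Rightarrow> nat" where
  "num2 k C l s = card {m \<in> {1..k}. m < l \<and>
     (Hor (nbr North (nbr East s)) \<in> C m \<or> Ver (nbr North (nbr East s)) \<in> C m)}"

definition hor_prob ::
  "(nat \<Rightarrow> real) \<Rightarrow> (nat \<Rightarrow> real) \<Rightarrow> real \<Rightarrow> nat \<Rightarrow> nat \<Rightarrow> (nat \<Rightarrow> domino set) \<Rightarrow> nat \<Rightarrow> sq \<Rightarrow> real" where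
  "hor_prob b c t k n C l s =
     (let i = nat ((diag n s + 1) div 2);
          w = c i * b (n - i + 1) * t ^ (num1 k n C l s + num2 k C l s)
      in w / (1 + w))"

definition fill_block :: "bool \<Rightarrow> sq \<Rightarrow> domino set" where
  "fill_block h s = (if h then {Hor s, Hor (nbr North s)} else {Ver s, Ver (nbr East s)})"

definition fill_color ::
  "(nat \<Rightarrow> real) \<Rightarrow> (nat \<Rightarrow> real) \<Rightarrow> real \<Rightarrow> nat \<Rightarrow> nat \<Rightarrow> nat \<Rightarrow> (nat \<Rightarrow> domino set)
     \<Rightarrow> (nat \<Rightarrow> domino set) pmf" where
  "fill_color b c t k n l C =
     (let B = creation_blocks n (C l)
      in map_pmf (\<lambda>h. C(l := C l \<union> (\<Union>s\<in>B. fill_block (h s) s)))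
           (Pi_pmf B False (\<lambda>s. bernoulli_pmf (hor_prob b c t k n C l s))))"

primrec fill_colors ::
  "(nat \<Rightarrow> real) \<Rightarrow> (nat \<Rightarrow> real) \<Rightarrow> real \<Rightarrow> nat \<Rightarrow> nat \<Rightarrow> nat \<Rightarrow> (nat \<Rightarrow> domino set)
     \<Rightarrow> (nat \<Rightarrow> domino set) pmf" where
  "fill_colors b c t k n 0 C = return_pmf C"
| "fill_colors b c t k n (Suc l) C =
     bind_pmf (fill_colors b c t k n l C) (fill_color b c t k n (Suc l))"

primrec kshuffle ::
  "(nat \<Rightarrow> real) \<Rightarrow> (nat \<Rightarrow> real) \<Rightarrow> real \<Rightarrow> nat \<Rightarrow> nat \<Rightarrow> (nat \<Rightarrow> domino set) pmf" where
  "kshuffle b c t k 0 = return_pmf (\<lambda>a\<in>{1..k}. {})"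
| "kshuffle b c t k (Suc n) =
     bind_pmf (kshuffle b c t k n)
       (\<lambda>T. fill_colors b c t k (Suc n) k (\<lambda>a\<in>{1..k}. slide_destroy n (T a)))"

end

theory Submission
  imports Defs
begin

text \<open>
  A step of the shuffle is a local move carried out simultaneously on a checkerboard of 2 by 2
  blocks.  Let the cells be the 2 by 2 blocks inside the diamond of rank \<open>n + 1\<close> whose lower-left
  square is white in that rank.  A domino of either diamond lies in exactly one cell; the squares of
  the diamond of rank \<open>n\<close> are those lying in two cells, and those of the diamond of rank \<open>n + 1\<close> lie in
  at least one.  Sliding moves a domino to the opposite side of its cell, and two dominoes of a
  tiling collide iff they share a cell.  So a step flips a domino that is alone in its cell, removes a parallel
  pair, and puts a pair into each empty cell.  In all three cases the part of the cell that is
  covered from inside is replaced by its complement, and this is why a tiling of rank \<open>n\<close> becomes a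
  tiling of rank \<open>n + 1\<close> (\<open>spider_complement\<close>, \<open>spider_tilings_iff\<close>).  The relation is symmetric: the
  predecessors of a tiling arise from it by the same move, one for every way of filling its
  empty cells.

  Domino weights and interactions both split into contributions of single cells
  (\<open>card_interactions_cells\<close>, \<open>card_interactions_Suc_cells\<close>).  For a transition from \<open>D\<close> to \<open>D'\<close>, a color
  \<open>a\<close> and a cell \<open>s\<close>, let \<open>e\<close> be the number of colors \<open>m < a\<close> whose dominoes in \<open>s\<close> leave its
  upper-right square uncovered in \<open>D'\<close>, plus the number of colors \<open>m > a\<close> whose dominoes in \<open>s\<close> cover
  its lower-left square in \<open>D'\<close>.  With \<open>x\<close> the product of the two horizontal weights of the cell,
  making a pair of color \<open>a\<close> in \<open>s\<close> horizontal instead of vertical multiplies the weight by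
  \<open>y = x t^e\<close>, both for a created pair in the weight of \<open>D'\<close> and for a destroyed pair in the weight of
  \<open>D\<close>; the rest of the two weights agrees (\<open>weight_exchange\<close>).  Which squares are covered inside a
  cell is the same for both ways of filling it, hence \<open>e\<close> does not depend on the fillings, and the
  algorithm makes the block horizontal with probability \<open>y / (1 + y)\<close>.  Summing over the
  predecessors of \<open>D'\<close>, its probability becomes its weight times the product of \<open>1 + y\<close> over
  its empty cells divided by the product of \<open>1 + y\<close> over its full cells.

  This quotient is the same for all \<open>D'\<close> (\<open>fulls_empties_exchange\<close>).  Let \<open>S j\<close> be the set of colors
  covering the lower-left square of the \<open>j\<close>-th cell of a diagonal from inside.  All colors are in the
  first of these sets, and none is left beyond the last cell.  The cell is full for the colors in
  \<open>S j - S (j + 1)\<close> and empty for those in \<open>S (j + 1) - S j\<close>.  If \<open>S j\<close> is turned into \<open>S (j + 1)\<close>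
  one color after another, \<open>e\<close> is the number of other colors present when \<open>a\<close> is processed, so the
  product telescopes to the product of \<open>1 + x t^l\<close> over \<open>l < k\<close>.  Induction on the rank
  finishes the proof.
\<close>

section \<open>Cells of the diamond\<close>

lemma mem_aztec:
  "(x, y) \<in> aztec n \<longleftrightarrow>
     - int n \<le> y - x \<and> y - x \<le> int n \<and> - int n - 1 \<le> x + y \<and> x + y \<le> int n - 1"
    (is "_ \<longleftrightarrow> ?R")
proof
  assume "(x, y) \<in> aztec n"
  then have *: "p \<in> unit_square (x, y) \<Longrightarrow> \<bar>fst p\<bar> + \<bar>snd p\<bar> \<le> real n + 1" for p
    by (auto simp: aztec_def)
  have 1: "\<bar>of_int x\<bar> + \<bar>of_int y\<bar> \<le> real n + 1"
    using *[of "(of_int x, of_int y)"] by (simp add: unit_square_def)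
  have 2: "\<bar>of_int x + 1\<bar> + \<bar>of_int y\<bar> \<le> real n + 1"
    using *[of "(of_int x + 1, of_int y)"] by (simp add: unit_square_def)
  have 3: "\<bar>of_int x\<bar> + \<bar>of_int y + 1\<bar> \<le> real n + 1"
    using *[of "(of_int x, of_int y + 1)"] by (simp add: unit_square_def)
  have 4: "\<bar>of_int x + 1\<bar> + \<bar>of_int y + 1\<bar> \<le> real n + 1"
    using *[of "(of_int x + 1, of_int y + 1)"] by (simp add: unit_square_def)
  show ?R using 1 2 3 4 by linarith
next
  assume r: ?R
  then have r': "- real n \<le> real_of_int y - real_of_int x" "real_of_int y - real_of_int x \<le> real n"
     "- real n - 1 \<le> real_of_int x + real_of_int y" "real_of_int x + real_of_int y \<le> real n - 1"
    by linarith+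
  show "(x, y) \<in> aztec n"
    unfolding aztec_def unit_square_def using r' by (auto simp: abs_real_def)
qed

definition cells :: "nat \<Rightarrow> sq set" where
  "cells n = {s. white (Suc n) s \<and> block s \<subseteq> aztec (Suc n)}"

lemma mem_cells:
  "(x, y) \<in> cells n \<longleftrightarrow> even (y - x + int n) \<and>
     - int n \<le> y - x \<and> y - x \<le> int n \<and> - int n - 2 \<le> x + y \<and> x + y \<le> int n - 2"
  unfolding cells_def block_def diag_def
  by (simp add: mem_aztec) presburger

lemma finite_aztec: "finite (aztec n)"
proof -
  have "aztec n \<subseteq> {- int n - 1..int n} \<times> {- int n - 1..int n}"
    by (auto simp: mem_aztec)
  then show ?thesis by (rule finite_subset) simp
qed

lemma finite_cells: "finite (cells n)"
proof -
  have "cells n \<subseteq> aztec (Suc n)"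
    by (auto simp: cells_def block_def)
  then show ?thesis using finite_aztec by (rule finite_subset)
qed

section \<open>Tilings in coordinates\<close>

lemma mem_squares:
  "(x, y) \<in> squares d \<longleftrightarrow> d \<in> {Hor (x, y), Hor (x - 1, y), Ver (x, y), Ver (x, y - 1)}"
proof (cases d)
  case (Hor s) then show ?thesis by (cases s) auto
next
  case (Ver s) then show ?thesis by (cases s) auto
qed

definition exactly_one4 :: "bool \<Rightarrow> bool \<Rightarrow> bool \<Rightarrow> bool \<Rightarrow> bool" where
  "exactly_one4 p q r s \<longleftrightarrow> (p \<or> q \<or> r \<or> s) \<and>
    \<not> (p \<and> q) \<and> \<not> (p \<and> r) \<and> \<not> (p \<and> s) \<and> \<not> (q \<and> r) \<and> \<not> (q \<and> s) \<and> \<not> (r \<and> s)"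

lemma ex1_four_iff:
  assumes "distinct [d1, d2, d3, d4]"
  shows "(\<exists>!d. d \<in> D \<and> d \<in> {d1, d2, d3, d4}) \<longleftrightarrow>
    exactly_one4 (d1 \<in> D) (d2 \<in> D) (d3 \<in> D) (d4 \<in> D)"
  using assms unfolding exactly_one4_def by auto

text \<open>
  The unique existence of a covering domino becomes a propositional condition on four memberships,
  so that statements about a single square can be decided by case distinction.
\<close>

lemma mem_tilings:
  "D \<in> tilings n \<longleftrightarrow> (\<forall>x y. if (x, y) \<in> aztec n
     then exactly_one4 (Hor (x, y) \<in> D) (Hor (x - 1, y) \<in> D) (Ver (x, y) \<in> D) (Ver (x, y - 1) \<in> D)
     else Hor (x, y) \<notin> D \<and> Hor (x - 1, y) \<notin> D \<and> Ver (x, y) \<notin> D \<and> Ver (x, y - 1) \<notin> D)"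
    (is "_ \<longleftrightarrow> (\<forall>x y. if _ then ?one x y else ?none x y)")
proof -
  have one: "(\<exists>!d. d \<in> D \<and> (x, y) \<in> squares d) \<longleftrightarrow> ?one x y" for x y
    unfolding mem_squares by (rule ex1_four_iff) auto
  have none: "(x, y) \<notin> covered D \<longleftrightarrow> ?none x y" for x y
    unfolding covered_def by (auto simp: mem_squares)
  have "D \<in> tilings n \<longleftrightarrow> (\<forall>x y. ((x, y) \<notin> aztec n \<longrightarrow> (x, y) \<notin> covered D) \<and>
      ((x, y) \<in> aztec n \<longrightarrow> (\<exists>!d. d \<in> D \<and> (x, y) \<in> squares d)))"
  proof -
    have "(\<forall>x y. P x y \<longrightarrow> Q x y) \<and> (\<forall>x y. Q x y \<longrightarrow> R x y) \<longleftrightarrow>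
        (\<forall>x y. (\<not> Q x y \<longrightarrow> \<not> P x y) \<and> (Q x y \<longrightarrow> R x y))" for P Q R :: "int \<Rightarrow> int \<Rightarrow> bool"
      by blast
    then show ?thesis
      unfolding tilings_def subset_iff Ball_def mem_Collect_eq split_paired_All .
  qed
  also have "\<dots> \<longleftrightarrow> (\<forall>x y. if (x, y) \<in> aztec n then ?one x y else ?none x y)"
    unfolding one none by auto
  finally show ?thesis .
qed

section \<open>Sliding inside a cell\<close>

lemma slide_simps:
  "slide n (Hor (x, y)) = (if even (y - x + int n) then Hor (x, y + 1) else Hor (x, y - 1))"
  "slide n (Ver (x, y)) = (if even (y - x + int n) then Ver (x + 1, y) else Ver (x - 1, y))"
  by (auto simp: diag_def)

text \<open>
  Parallel dominoes of the same cell have opposite types, so sliding interchanges them.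
\<close>

lemma slide_slide: "slide n (slide n d) = d"
proof (cases d)
  case (Hor s) then show ?thesis by (cases s) (auto simp: slide_simps simp del: slide.simps)
next
  case (Ver s) then show ?thesis by (cases s) (auto simp: slide_simps simp del: slide.simps)
qed

lemma collide_iff_slide: "collide n d e \<or> collide n e d \<longleftrightarrow> e = slide n d"
proof (cases d)
  case (Hor s)
  then show ?thesis
    by (cases s; cases e) (auto simp: collide_def diag_def)
next
  case (Ver s)
  then show ?thesis
    by (cases s; cases e) (auto simp: collide_def diag_def)
qed

lemma mem_slide_destroy: "d \<in> slide_destroy n D \<longleftrightarrow> slide n d \<in> D \<and> d \<notin> D"
proof -
  have "slide_destroy n D = slide n ` {d \<in> D. slide n d \<notin> D}"
    unfolding slide_destroy_def collide_iff_slide by auto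
  then show ?thesis
    by (auto simp: slide_slide) (metis (mono_tags, lifting) image_eqI mem_Collect_eq slide_slide)
qed

section \<open>The spider move\<close>

definition empties :: "nat \<Rightarrow> domino set \<Rightarrow> sq set" where
  "empties n D = {s \<in> cells n. Hor s \<notin> D \<and> Hor (nbr North s) \<notin> D \<and> Ver s \<notin> D \<and> Ver (nbr East s) \<notin> D}"

definition cell_dominoes :: "nat \<Rightarrow> domino set" where
  "cell_dominoes n = (\<Union>s\<in>cells n. {Hor s, Hor (nbr North s), Ver s, Ver (nbr East s)})"

lemma mem_cell_dominoes:
  "Hor (x, y) \<in> cell_dominoes n \<longleftrightarrow> (x, y) \<in> cells n \<or> (x, y - 1) \<in> cells n"
  "Ver (x, y) \<in> cell_dominoes n \<longleftrightarrow> (x, y) \<in> cells n \<or> (x - 1, y) \<in> cells n"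
proof -
  have H: "Hor (x, y) \<in> {Hor s, Hor (nbr North s), Ver s, Ver (nbr East s)} \<longleftrightarrow>
      s = (x, y) \<or> s = (x, y - 1)" for s
    by (cases s) auto
  have V: "Ver (x, y) \<in> {Hor s, Hor (nbr North s), Ver s, Ver (nbr East s)} \<longleftrightarrow>
      s = (x, y) \<or> s = (x - 1, y)" for s
    by (cases s) auto
  show "Hor (x, y) \<in> cell_dominoes n \<longleftrightarrow> (x, y) \<in> cells n \<or> (x, y - 1) \<in> cells n"
    unfolding cell_dominoes_def UN_iff H by blast
  show "Ver (x, y) \<in> cell_dominoes n \<longleftrightarrow> (x, y) \<in> cells n \<or> (x - 1, y) \<in> cells n"
    unfolding cell_dominoes_def UN_iff V by blast
qed

lemma mem_cell_dominoes_even: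
  assumes "even (y - x + int n)"
  shows "Hor (x, y) \<in> cell_dominoes n \<longleftrightarrow> (x, y) \<in> cells n"
    and "Ver (x, y) \<in> cell_dominoes n \<longleftrightarrow> (x, y) \<in> cells n"
  using assms unfolding mem_cell_dominoes by (auto simp: mem_cells)

lemma mem_cell_dominoes_odd:
  assumes "odd (y - x + int n)"
  shows "Hor (x, y) \<in> cell_dominoes n \<longleftrightarrow> (x, y - 1) \<in> cells n"
    and "Ver (x, y) \<in> cell_dominoes n \<longleftrightarrow> (x - 1, y) \<in> cells n"
  using assms unfolding mem_cell_dominoes by (auto simp: mem_cells)

text \<open>
  The four components say which of the bottom, top, left and right dominoes of a cell are present.
  The table is that of urban renewal: an empty cell and a cell with a parallel pair are exchanged, and
  a single domino moves to the opposite side.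
\<close>

fun swap_states :: "bool \<times> bool \<times> bool \<times> bool \<Rightarrow> bool \<times> bool \<times> bool \<times> bool \<Rightarrow> bool" where
  "swap_states (B, T, L, R) (B', T', L', R') \<longleftrightarrow>
     (\<not> B \<and> \<not> T \<and> \<not> L \<and> \<not> R \<and> (B' \<and> T' \<and> \<not> L' \<and> \<not> R' \<or> \<not> B' \<and> \<not> T' \<and> L' \<and> R')) \<or>
     (\<not> B' \<and> \<not> T' \<and> \<not> L' \<and> \<not> R' \<and> (B \<and> T \<and> \<not> L \<and> \<not> R \<or> \<not> B \<and> \<not> T \<and> L \<and> R)) \<or>
     (exactly_one4 B T L R \<and> B' = T \<and> T' = B \<and> L' = R \<and> R' = L)"

definition state :: "domino set \<Rightarrow> sq \<Rightarrow> bool \<times> bool \<times> bool \<times> bool" where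
  "state D s = (Hor s \<in> D, Hor (nbr North s) \<in> D, Ver s \<in> D, Ver (nbr East s) \<in> D)"

definition spider :: "nat \<Rightarrow> domino set \<Rightarrow> domino set \<Rightarrow> bool" where
  "spider n D D' \<longleftrightarrow> D \<subseteq> cell_dominoes n \<and> D' \<subseteq> cell_dominoes n \<and>
     (\<forall>s\<in>cells n. swap_states (state D s) (state D' s))"

lemma swap_states_sym: "swap_states p q \<longleftrightarrow> swap_states q p"
  by (cases p; cases q) (auto simp: exactly_one4_def)

lemma spider_sym: "spider n D D' \<longleftrightarrow> spider n D' D"
  unfolding spider_def using swap_states_sym by blast

text \<open>
  The cell of a domino is found from the parity of its diagonal; it fits into the larger diamond
  because the domino does.
\<close>

lemma tiling_subset_cell_dominoes:
  assumes "D \<in> tilings n \<or> D \<in> tilings (Suc n)"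
  shows "D \<subseteq> cell_dominoes n"
proof
  fix d assume d: "d \<in> D"
  have inside: "squares d \<subseteq> aztec (Suc n)"
  proof -
    have "aztec n \<subseteq> aztec (Suc n)" by (auto simp: mem_aztec)
    then have "covered D \<subseteq> aztec (Suc n)" using assms by (auto simp: tilings_def)
    moreover have "squares d \<subseteq> covered D" using d by (auto simp: covered_def)
    ultimately show ?thesis by blast
  qed
  show "d \<in> cell_dominoes n"
  proof (cases d)
    case (Hor s)
    obtain x y where "s = (x, y)" by (cases s)
    then have "(x, y) \<in> aztec (Suc n)" "(x + 1, y) \<in> aztec (Suc n)" using inside Hor by auto
    then show ?thesis unfolding Hor \<open>s = (x, y)\<close> mem_cell_dominoes mem_cells mem_aztec by simp presburger
  next
    case (Ver s)
    obtain x y where "s = (x, y)" by (cases s)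
    then have "(x, y) \<in> aztec (Suc n)" "(x, y + 1) \<in> aztec (Suc n)" using inside Ver by auto
    then show ?thesis unfolding Ver \<open>s = (x, y)\<close> mem_cell_dominoes mem_cells mem_aztec by simp presburger
  qed
qed

text \<open>
  A square of even parity here is the lower-left corner of one possible cell and the upper-right
  corner of another; the odd squares are the upper-left and lower-right corners.
\<close>

lemma aztec_even:
  assumes "even (y - x + int n)"
  shows "(x, y) \<in> aztec (Suc n) \<longleftrightarrow> (x, y) \<in> cells n \<or> (x - 1, y - 1) \<in> cells n"
    and "(x, y) \<in> aztec n \<longleftrightarrow> (x, y) \<in> cells n \<and> (x - 1, y - 1) \<in> cells n"
  using assms unfolding mem_aztec mem_cells by presburger+

lemma aztec_odd:
  assumes "odd (y - x + int n)"
  shows "(x, y) \<in> aztec (Suc n) \<longleftrightarrow> (x, y - 1) \<in> cells n \<or> (x - 1, y) \<in> cells n"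
    and "(x, y) \<in> aztec n \<longleftrightarrow> (x, y - 1) \<in> cells n \<and> (x - 1, y) \<in> cells n"
  using assms unfolding mem_aztec mem_cells by presburger+

lemma tiling_cell_disjoint:
  assumes "D \<in> tilings r"
  shows "\<not> (Hor (x, y) \<in> D \<and> Ver (x, y) \<in> D)"
    and "\<not> (Hor (x, y) \<in> D \<and> Ver (x + 1, y) \<in> D)"
    and "\<not> (Hor (x, y + 1) \<in> D \<and> Ver (x, y) \<in> D)"
    and "\<not> (Hor (x, y + 1) \<in> D \<and> Ver (x + 1, y) \<in> D)"
proof -
  have *: "if (x, y) \<in> aztec r
     then exactly_one4 (Hor (x, y) \<in> D) (Hor (x - 1, y) \<in> D) (Ver (x, y) \<in> D) (Ver (x, y - 1) \<in> D)
     else Hor (x, y) \<notin> D \<and> Hor (x - 1, y) \<notin> D \<and> Ver (x, y) \<notin> D \<and> Ver (x, y - 1) \<notin> D" for x y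
    using assms unfolding mem_tilings by blast
  show "\<not> (Hor (x, y) \<in> D \<and> Ver (x, y) \<in> D)" using *[of x y]
    by (auto simp: exactly_one4_def split: if_splits)
  show "\<not> (Hor (x, y) \<in> D \<and> Ver (x + 1, y) \<in> D)" using *[of "x + 1" y]
    by (auto simp: exactly_one4_def split: if_splits)
  show "\<not> (Hor (x, y + 1) \<in> D \<and> Ver (x, y) \<in> D)" using *[of x "y + 1"]
    by (auto simp: exactly_one4_def split: if_splits)
  show "\<not> (Hor (x, y + 1) \<in> D \<and> Ver (x + 1, y) \<in> D)" using *[of "x + 1" "y + 1"]
    by (auto simp: exactly_one4_def split: if_splits)
qed

text \<open>
  The central property of the move: each corner of a cell is covered from inside after the move iff
  it was not covered from inside before.
\<close>

lemma spider_complement: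
  assumes "spider n D D'" and "(x, y) \<in> cells n"
  shows "Hor (x, y) \<in> D' \<or> Ver (x, y) \<in> D' \<longleftrightarrow> \<not> (Hor (x, y) \<in> D \<or> Ver (x, y) \<in> D)"
    and "Hor (x, y) \<in> D' \<or> Ver (x + 1, y) \<in> D' \<longleftrightarrow> \<not> (Hor (x, y) \<in> D \<or> Ver (x + 1, y) \<in> D)"
    and "Hor (x, y + 1) \<in> D' \<or> Ver (x, y) \<in> D' \<longleftrightarrow> \<not> (Hor (x, y + 1) \<in> D \<or> Ver (x, y) \<in> D)"
    and "Hor (x, y + 1) \<in> D' \<or> Ver (x + 1, y) \<in> D' \<longleftrightarrow> \<not> (Hor (x, y + 1) \<in> D \<or> Ver (x + 1, y) \<in> D)"
    and "\<not> (Hor (x, y) \<in> D' \<and> Ver (x, y) \<in> D')"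
    and "\<not> (Hor (x, y) \<in> D' \<and> Ver (x + 1, y) \<in> D')"
    and "\<not> (Hor (x, y + 1) \<in> D' \<and> Ver (x, y) \<in> D')"
    and "\<not> (Hor (x, y + 1) \<in> D' \<and> Ver (x + 1, y) \<in> D')"
proof -
  have "swap_states (state D (x, y)) (state D' (x, y))"
    using assms unfolding spider_def by blast
  then have *: "swap_states (Hor (x, y) \<in> D, Hor (x, y + 1) \<in> D, Ver (x, y) \<in> D, Ver (x + 1, y) \<in> D)
    (Hor (x, y) \<in> D', Hor (x, y + 1) \<in> D', Ver (x, y) \<in> D', Ver (x + 1, y) \<in> D')"
    by (simp add: state_def)
  show "Hor (x, y) \<in> D' \<or> Ver (x, y) \<in> D' \<longleftrightarrow> \<not> (Hor (x, y) \<in> D \<or> Ver (x, y) \<in> D)"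
    and "Hor (x, y) \<in> D' \<or> Ver (x + 1, y) \<in> D' \<longleftrightarrow> \<not> (Hor (x, y) \<in> D \<or> Ver (x + 1, y) \<in> D)"
    and "Hor (x, y + 1) \<in> D' \<or> Ver (x, y) \<in> D' \<longleftrightarrow> \<not> (Hor (x, y + 1) \<in> D \<or> Ver (x, y) \<in> D)"
    and "Hor (x, y + 1) \<in> D' \<or> Ver (x + 1, y) \<in> D' \<longleftrightarrow> \<not> (Hor (x, y + 1) \<in> D \<or> Ver (x + 1, y) \<in> D)"
    and "\<not> (Hor (x, y) \<in> D' \<and> Ver (x, y) \<in> D')"
    and "\<not> (Hor (x, y) \<in> D' \<and> Ver (x + 1, y) \<in> D')"
    and "\<not> (Hor (x, y + 1) \<in> D' \<and> Ver (x, y) \<in> D')"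
    and "\<not> (Hor (x, y + 1) \<in> D' \<and> Ver (x + 1, y) \<in> D')"
    using * unfolding swap_states.simps exactly_one4_def by argo+
qed

lemma outside_cells:
  assumes "D \<subseteq> cell_dominoes n" "even (y - x + int n)" "(x, y) \<notin> cells n"
  shows "Hor (x, y) \<notin> D" "Ver (x, y) \<notin> D" "Hor (x, y + 1) \<notin> D" "Ver (x + 1, y) \<notin> D"
  using assms mem_cell_dominoes_even[of y x n] mem_cell_dominoes_odd(1)[of "y + 1" x n]
    mem_cell_dominoes_odd(2)[of y "x + 1" n] by auto

text \<open>
  A square in two cells is covered from exactly one of them, and complementing both coverages
  preserves this.  A square in only one cell is uncovered in rank \<open>n\<close> and
  covered in rank \<open>n + 1\<close>.
\<close>

lemma spider_tilings_iff:
  assumes sp: "spider n D D'"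
  shows "D \<in> tilings n \<longleftrightarrow> D' \<in> tilings (Suc n)"
proof -
  have sub: "D \<subseteq> cell_dominoes n" "D' \<subseteq> cell_dominoes n" using sp by (auto simp: spider_def)
  have sp': "spider n D' D" using sp spider_sym by blast
  have "(if (x, y) \<in> aztec n
     then exactly_one4 (Hor (x, y) \<in> D) (Hor (x - 1, y) \<in> D) (Ver (x, y) \<in> D) (Ver (x, y - 1) \<in> D)
     else Hor (x, y) \<notin> D \<and> Hor (x - 1, y) \<notin> D \<and> Ver (x, y) \<notin> D \<and> Ver (x, y - 1) \<notin> D) \<longleftrightarrow>
     (if (x, y) \<in> aztec (Suc n)
     then exactly_one4 (Hor (x, y) \<in> D') (Hor (x - 1, y) \<in> D') (Ver (x, y) \<in> D') (Ver (x, y - 1) \<in> D')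
     else Hor (x, y) \<notin> D' \<and> Hor (x - 1, y) \<notin> D' \<and> Ver (x, y) \<notin> D' \<and> Ver (x, y - 1) \<notin> D')" for x y
  proof (cases "even (y - x + int n)")
    case True
    then have ev: "even (y - 1 - (x - 1) + int n)" by simp
    have "(x, y) \<in> cells n \<or> (x, y) \<notin> cells n" "(x - 1, y - 1) \<in> cells n \<or> (x - 1, y - 1) \<notin> cells n"
      by auto
    then show ?thesis
      unfolding aztec_even[OF True] exactly_one4_def
      using spider_complement[OF sp, of x y] spider_complement[OF sp', of x y]
        spider_complement[OF sp, of "x - 1" "y - 1"] spider_complement[OF sp', of "x - 1" "y - 1"]
        outside_cells[OF sub(1) True] outside_cells[OF sub(2) True]
        outside_cells[OF sub(1) ev] outside_cells[OF sub(2) ev]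
      by (elim disjE) (simp_all, argo+)
  next
    case False
    then have ev: "even (y - 1 - x + int n)" "even (y - (x - 1) + int n)" by presburger+
    have "(x, y - 1) \<in> cells n \<or> (x, y - 1) \<notin> cells n" "(x - 1, y) \<in> cells n \<or> (x - 1, y) \<notin> cells n"
      by auto
    then show ?thesis
      unfolding aztec_odd[OF False] exactly_one4_def
      using spider_complement[OF sp, of x "y - 1"] spider_complement[OF sp', of x "y - 1"]
        spider_complement[OF sp, of "x - 1" y] spider_complement[OF sp', of "x - 1" y]
        outside_cells[OF sub(1) ev(1)] outside_cells[OF sub(2) ev(1)]
        outside_cells[OF sub(1) ev(2)] outside_cells[OF sub(2) ev(2)]
      by (elim disjE) (simp_all, argo+)
  qed
  then show ?thesis unfolding mem_tilings by blast
qed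

text \<open>
  A shuffle step with prescribed fillings.  The same operation, applied to a tiling of rank \<open>n + 1\<close>,
  produces its predecessors.
\<close>

definition refill :: "nat \<Rightarrow> domino set \<Rightarrow> (sq \<Rightarrow> bool) \<Rightarrow> domino set" where
  "refill n D h = slide_destroy n D \<union> (\<Union>s\<in>empties n D. fill_block (h s) s)"

lemma slide_cell:
  assumes "s \<in> cells n"
  shows "slide n (Hor s) = Hor (nbr North s)" "slide n (Hor (nbr North s)) = Hor s"
    "slide n (Ver s) = Ver (nbr East s)" "slide n (Ver (nbr East s)) = Ver s"
proof -
  obtain x y where s: "s = (x, y)" by (cases s)
  have "even (y - x + int n)" using assms s by (simp add: mem_cells)
  then show *: "slide n (Hor s) = Hor (nbr North s)" "slide n (Ver s) = Ver (nbr East s)"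
    unfolding s slide_simps by simp_all
  show "slide n (Hor (nbr North s)) = Hor s" "slide n (Ver (nbr East s)) = Ver s"
    unfolding *[symmetric] slide_slide by simp_all
qed

lemma state_slide_destroy:
  assumes "s \<in> cells n"
  shows "state (slide_destroy n D) s = 
    (Hor (nbr North s) \<in> D \<and> Hor s \<notin> D, Hor s \<in> D \<and> Hor (nbr North s) \<notin> D,
     Ver (nbr East s) \<in> D \<and> Ver s \<notin> D, Ver s \<in> D \<and> Ver (nbr East s) \<notin> D)"
  unfolding state_def mem_slide_destroy slide_cell[OF assms] ..

lemma state_fill:
  assumes "s \<in> cells n" "E \<subseteq> cells n"
  shows "state (\<Union>s\<in>E. fill_block (h s) s) s = (s \<in> E \<and> h s, s \<in> E \<and> h s, s \<in> E \<and> \<not> h s, s \<in> E \<and> \<not> h s)"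
proof -
  obtain x y where s: "s = (x, y)" by (cases s)
  have par: "even (y - x + int n)" using assms s by (simp add: mem_cells)
  have ev: "even (b - a + int n)" if "(a, b) \<in> E" for a b
    using that assms by (auto simp: mem_cells)
  have no: "(x, y - 1) \<notin> E" "(x - 1, y) \<notin> E" "(x, y + 1) \<notin> E" "(x + 1, y) \<notin> E"
    using par ev[of x "y - 1"] ev[of "x - 1" y] ev[of x "y + 1"] ev[of "x + 1" y] by auto
  have 1: "Hor (p, q) \<in> fill_block b (u, v) \<longleftrightarrow> b \<and> ((u, v) = (p, q) \<or> (u, v) = (p, q - 1))"
    "Ver (p, q) \<in> fill_block b (u, v) \<longleftrightarrow> \<not> b \<and> ((u, v) = (p, q) \<or> (u, v) = (p - 1, q))" for p q b u v
    by (auto simp: fill_block_def)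
  have 2: "Hor (p, q) \<in> (\<Union>s\<in>E. fill_block (h s) s) \<longleftrightarrow>
      (p, q) \<in> E \<and> h (p, q) \<or> (p, q - 1) \<in> E \<and> h (p, q - 1)"
    "Ver (p, q) \<in> (\<Union>s\<in>E. fill_block (h s) s) \<longleftrightarrow>
      (p, q) \<in> E \<and> \<not> h (p, q) \<or> (p - 1, q) \<in> E \<and> \<not> h (p - 1, q)" for p q
  proof -
    have "(\<exists>s\<in>E. P s) \<longleftrightarrow> (\<exists>u v. (u, v) \<in> E \<and> P (u, v))" for P by auto
    then show "Hor (p, q) \<in> (\<Union>s\<in>E. fill_block (h s) s) \<longleftrightarrow>
      (p, q) \<in> E \<and> h (p, q) \<or> (p, q - 1) \<in> E \<and> h (p, q - 1)"
    "Ver (p, q) \<in> (\<Union>s\<in>E. fill_block (h s) s) \<longleftrightarrow>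
      (p, q) \<in> E \<and> \<not> h (p, q) \<or> (p - 1, q) \<in> E \<and> \<not> h (p - 1, q)"
      unfolding UN_iff by (auto simp: 1)
  qed
  show ?thesis unfolding s state_def nbr.simps 2 using no by simp
qed

lemma state_Un: "state (A \<union> B) s =
    (let (a1, a2, a3, a4) = state A s; (b1, b2, b3, b4) = state B s in (a1 \<or> b1, a2 \<or> b2, a3 \<or> b3, a4 \<or> b4))"
  by (simp add: state_def)

lemma empties_subset: "empties n D \<subseteq> cells n"
  by (auto simp: empties_def)

lemma state_refill:
  assumes "s \<in> cells n"
  shows "state (refill n D h) s = (if s \<in> empties n D then (h s, h s, \<not> h s, \<not> h s)
    else (Hor (nbr North s) \<in> D \<and> Hor s \<notin> D, Hor s \<in> D \<and> Hor (nbr North s) \<notin> D,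
     Ver (nbr East s) \<in> D \<and> Ver s \<notin> D, Ver s \<in> D \<and> Ver (nbr East s) \<notin> D))"
  unfolding refill_def state_Un state_slide_destroy[OF assms] state_fill[OF assms empties_subset]
  using assms by (auto simp: empties_def)

lemma slide_mem_cell_dominoes: "slide n d \<in> cell_dominoes n \<longleftrightarrow> d \<in> cell_dominoes n"
proof -
  have "d \<in> cell_dominoes n \<Longrightarrow> slide n d \<in> cell_dominoes n" for d
  proof -
    assume "d \<in> cell_dominoes n"
    then obtain s where s: "s \<in> cells n" and d: "d \<in> {Hor s, Hor (nbr North s), Ver s, Ver (nbr East s)}"
      unfolding cell_dominoes_def by blast
    from d have "slide n d \<in> {Hor s, Hor (nbr North s), Ver s, Ver (nbr East s)}"
      by (elim insertE) (simp_all add: slide_cell[OF s] del: slide.simps)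
    with s show ?thesis unfolding cell_dominoes_def by blast
  qed
  then show ?thesis using slide_slide by metis
qed

lemma slide_destroy_subset:
  assumes "D \<subseteq> cell_dominoes n"
  shows "slide_destroy n D \<subseteq> cell_dominoes n"
  using assms slide_mem_cell_dominoes by (auto simp: mem_slide_destroy)

lemma refill_subset:
  assumes "D \<subseteq> cell_dominoes n"
  shows "refill n D h \<subseteq> cell_dominoes n"
proof -
  have "(\<Union>s\<in>empties n D. fill_block (h s) s) \<subseteq> cell_dominoes n"
    by (auto simp: fill_block_def cell_dominoes_def empties_def)
  then show ?thesis using slide_destroy_subset[OF assms] by (auto simp: refill_def)
qed

lemma spider_refill:
  assumes D: "D \<in> tilings n \<or> D \<in> tilings (Suc n)"
  shows "spider n D (refill n D h)"
proof -
  have "swap_states (state D s) (state (refill n D h) s)" if "s \<in> cells n" for s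
  proof -
    obtain x y where s: "s = (x, y)" by (cases s)
    have dis: "\<not> (Hor (x, y) \<in> D \<and> Ver (x, y) \<in> D)" "\<not> (Hor (x, y) \<in> D \<and> Ver (x + 1, y) \<in> D)"
       "\<not> (Hor (x, y + 1) \<in> D \<and> Ver (x, y) \<in> D)" "\<not> (Hor (x, y + 1) \<in> D \<and> Ver (x + 1, y) \<in> D)"
      using D tiling_cell_disjoint by blast+
    show ?thesis
      unfolding state_refill[OF that] using that dis unfolding s empties_def
      by (cases "h (x, y)") (auto simp: state_def exactly_one4_def)
  qed
  then show ?thesis
    unfolding spider_def using refill_subset tiling_subset_cell_dominoes[OF D] by blast
qed

lemma state_eqI:
  assumes "D \<subseteq> cell_dominoes n" "D' \<subseteq> cell_dominoes n" "\<And>s. s \<in> cells n \<Longrightarrow> state D s = state D' s"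
  shows "D = D'"
proof -
  have "A \<subseteq> B" if "A \<subseteq> cell_dominoes n" "\<And>s. s \<in> cells n \<Longrightarrow> state A s = state B s" for A B
    using that unfolding cell_dominoes_def state_def by blast
  from this[of D D'] this[of D' D] show ?thesis using assms by auto
qed

definition fulls :: "nat \<Rightarrow> domino set \<Rightarrow> sq set" where
  "fulls n D = {s \<in> cells n. Hor s \<in> D \<and> Hor (nbr North s) \<in> D \<or> Ver s \<in> D \<and> Ver (nbr East s) \<in> D}"

lemma spider_state:
  assumes "spider n D D'" "s \<in> cells n"
  shows "swap_states (Hor s \<in> D, Hor (nbr North s) \<in> D, Ver s \<in> D, Ver (nbr East s) \<in> D)
    (Hor s \<in> D', Hor (nbr North s) \<in> D', Ver s \<in> D', Ver (nbr East s) \<in> D')"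
  using assms unfolding spider_def state_def by blast

lemma spider_empties:
  assumes "spider n D D'"
  shows "empties n D = fulls n D'"
  using spider_state[OF assms] unfolding empties_def fulls_def swap_states.simps exactly_one4_def
  by blast

text \<open>
  A transition is determined by its starting point together with the orientations of the new pairs, which
  can be read off from the bottom dominoes.
\<close>

lemma spider_imp_refill:
  assumes sp: "spider n D D'"
  shows "D' = refill n D (\<lambda>s. Hor s \<in> D')"
proof (rule state_eqI)
  show "D' \<subseteq> cell_dominoes n" "refill n D (\<lambda>s. Hor s \<in> D') \<subseteq> cell_dominoes n"
    using sp refill_subset by (auto simp: spider_def)
  fix s assume s: "s \<in> cells n"
  show "state D' s = state (refill n D (\<lambda>s. Hor s \<in> D')) s"
    unfolding state_refill[OF s] using spider_state[OF sp s] s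
    unfolding empties_def state_def swap_states.simps exactly_one4_def by auto
qed

lemma Hor_mem_refill:
  assumes "s \<in> empties n D"
  shows "Hor s \<in> refill n D h \<longleftrightarrow> h s"
  using state_refill[of s n D h] assms empties_subset by (auto simp: state_def)

section \<open>Creation blocks are the empty cells\<close>

lemma mem_covered:
  "(x, y) \<in> covered D \<longleftrightarrow> Hor (x, y) \<in> D \<or> Hor (x - 1, y) \<in> D \<or> Ver (x, y) \<in> D \<or> Ver (x, y - 1) \<in> D"
  unfolding covered_def by (auto simp: mem_squares)

lemma mem_block: "(x, y) \<in> block (a, b) \<longleftrightarrow> (a, b) \<in> {(x, y), (x - 1, y), (x, y - 1), (x - 1, y - 1)}"
  unfolding block_def by auto

lemma finite_block_family:
  assumes "finite (\<Union>s\<in>A. block s)"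
  shows "finite A"
proof (rule finite_subset[OF _ assms])
  show "A \<subseteq> (\<Union>s\<in>A. block s)" by (auto simp: block_def)
qed

text \<open>
  Among the blocks belonging to only one of two decompositions take one with the least sum of
  coordinates.  The other decomposition covers its lower-left square by a different block, whose sum
  of coordinates is smaller, so that block belongs to both decompositions and overlaps the chosen one.
\<close>

lemma block_decomposition_unique:
  assumes A: "disjoint_family_on block A" and B: "disjoint_family_on block B"
    and eq: "(\<Union>s\<in>A. block s) = (\<Union>s\<in>B. block s)" and fin: "finite (\<Union>s\<in>A. block s)"
  shows "A = B"
proof (rule ccontr)
  assume "A \<noteq> B"
  define X where "X = (A - B) \<union> (B - A)"
  have "finite A" "finite B"
    using finite_block_family[OF fin] finite_block_family[OF fin[unfolded eq]] by blast+
  then have "finite X" by (simp add: X_def)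
  have "X \<noteq> {}" using \<open>A \<noteq> B\<close> unfolding X_def by blast
  then obtain s where s: "s \<in> X" and min: "\<And>t. t \<in> X \<Longrightarrow> fst s + snd s \<le> fst t + snd t"
    using ex_is_arg_min_if_finite[OF \<open>finite X\<close>, of "\<lambda>t. fst t + snd t"]
    unfolding is_arg_min_linorder by blast
  have False if C: "disjoint_family_on block C"
    and sub: "s \<in> (\<Union>s\<in>C'. block s)" and notin: "s \<notin> C'" "s \<in> C" and X: "\<And>t. t \<in> C' \<Longrightarrow> t \<notin> C \<Longrightarrow> t \<in> X"
    for C C'
  proof -
    obtain t where t: "t \<in> C'" "s \<in> block t" using sub by blast
    have "t \<noteq> s" using t notin by auto
    then have "fst t + snd t < fst s + snd s"
      using t(2) by (cases s; cases t) (auto simp: mem_block)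
    then have "t \<in> C" using min[of t] X[OF t(1)] by fastforce
    moreover have "s \<in> block s" by (simp add: block_def)
    ultimately show False using C \<open>t \<noteq> s\<close> t(2) notin(2) unfolding disjoint_family_on_def by blast
  qed
  from this[of A B] this[of B A] s A B eq show False
    unfolding X_def by (auto simp: block_def)
qed

text \<open>
  A square in two cells is covered by the old tiling from one of them only; after the slide it can
  be covered only from the other, and it is unless that cell was empty.  Two empty cells
  cannot share a square, because the old tiling would leave it uncovered.
\<close>

lemma tiling_slide_destroy_uncovered:
  assumes D: "D \<in> tilings n"
  shows "(x, y) \<in> aztec (Suc n) - covered (slide_destroy n D) \<longleftrightarrow> (\<exists>s\<in>empties n D. (x, y) \<in> block s)"
    and "s \<in> empties n D \<Longrightarrow> t \<in> empties n D \<Longrightarrow> (x, y) \<in> block s \<Longrightarrow> (x, y) \<in> block t \<Longrightarrow> s = t"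
proof -
  let ?P = "slide_destroy n D"
  have sub: "D \<subseteq> cell_dominoes n" using D tiling_subset_cell_dominoes by blast
  have subP: "?P \<subseteq> cell_dominoes n" using sub slide_destroy_subset by blast
  have st: "(Hor (a, b) \<in> ?P \<longleftrightarrow> Hor (a, b + 1) \<in> D \<and> Hor (a, b) \<notin> D) \<and>
      (Hor (a, b + 1) \<in> ?P \<longleftrightarrow> Hor (a, b) \<in> D \<and> Hor (a, b + 1) \<notin> D) \<and>
      (Ver (a, b) \<in> ?P \<longleftrightarrow> Ver (a + 1, b) \<in> D \<and> Ver (a, b) \<notin> D) \<and>
      (Ver (a + 1, b) \<in> ?P \<longleftrightarrow> Ver (a, b) \<in> D \<and> Ver (a + 1, b) \<notin> D) \<and>
      ((a, b) \<in> empties n D \<longleftrightarrow> Hor (a, b) \<notin> D \<and> Hor (a, b + 1) \<notin> D \<and> Ver (a, b) \<notin> D \<and> Ver (a + 1, b) \<notin> D)"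
    if "(a, b) \<in> cells n" for a b
    using state_slide_destroy[OF that, of D] that by (simp add: state_def empties_def)
  have st': "(a, b) \<notin> empties n D" if "(a, b) \<notin> cells n" for a b
    using that empties_subset by blast
  have tile: "if (x, y) \<in> aztec n
     then exactly_one4 (Hor (x, y) \<in> D) (Hor (x - 1, y) \<in> D) (Ver (x, y) \<in> D) (Ver (x, y - 1) \<in> D)
     else Hor (x, y) \<notin> D \<and> Hor (x - 1, y) \<notin> D \<and> Ver (x, y) \<notin> D \<and> Ver (x, y - 1) \<notin> D"
    using D unfolding mem_tilings by blast
  have ev_e: "even (b - a + int n)" if "(a, b) \<in> empties n D" for a b
    using that empties_subset mem_cells by blast
  have ex: "(\<exists>s\<in>empties n D. (x, y) \<in> block s) \<longleftrightarrow> (x, y) \<in> empties n D \<or> (x - 1, y) \<in> empties n D \<or>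
      (x, y - 1) \<in> empties n D \<or> (x - 1, y - 1) \<in> empties n D"
    by (force simp: mem_block)
  have "((x, y) \<in> aztec (Suc n) - covered ?P \<longleftrightarrow> (\<exists>s\<in>empties n D. (x, y) \<in> block s)) \<and>
     (s \<in> empties n D \<longrightarrow> t \<in> empties n D \<longrightarrow> (x, y) \<in> block s \<longrightarrow> (x, y) \<in> block t \<longrightarrow> s = t)"
  proof (cases "even (y - x + int n)")
    case True
    then have ev: "even (y - 1 - (x - 1) + int n)" by simp
    have no: "(x - 1, y) \<notin> empties n D" "(x, y - 1) \<notin> empties n D"
      using ev_e[of "x - 1" y] ev_e[of x "y - 1"] True by auto
    have 2: "s = (x, y) \<or> s = (x - 1, y - 1)" if "s \<in> empties n D" "(x, y) \<in> block s" for s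
      using that no by (cases s) (auto simp: mem_block)
    have 3: "\<not> ((x, y) \<in> empties n D \<and> (x - 1, y - 1) \<in> empties n D)"
      using tile st[of x y] st[of "x - 1" "y - 1"] st' unfolding aztec_even[OF True] exactly_one4_def
      by (smt (verit))
    have "(x, y) \<in> aztec (Suc n) - covered ?P \<longleftrightarrow> (x, y) \<in> empties n D \<or> (x - 1, y - 1) \<in> empties n D"
      using tile outside_cells[OF sub True] outside_cells[OF subP True] outside_cells[OF sub ev] outside_cells[OF subP ev]
        st[of x y] st[of "x - 1" "y - 1"] st'[of x y] st'[of "x - 1" "y - 1"]
        tiling_cell_disjoint[OF D, of x y] tiling_cell_disjoint[OF D, of "x - 1" "y - 1"]
      unfolding Diff_iff aztec_even[OF True] exactly_one4_def mem_covered
      by (cases "(x, y) \<in> cells n"; cases "(x - 1, y - 1) \<in> cells n") (simp_all, argo+)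
    with 2 3 no show ?thesis unfolding ex by blast
  next
    case False
    then have ev: "even (y - 1 - x + int n)" "even (y - (x - 1) + int n)" by presburger+
    have no: "(x, y) \<notin> empties n D" "(x - 1, y - 1) \<notin> empties n D"
      using ev_e[of x y] ev_e[of "x - 1" "y - 1"] False by auto
    have 2: "s = (x, y - 1) \<or> s = (x - 1, y)" if "s \<in> empties n D" "(x, y) \<in> block s" for s
      using that no by (cases s) (auto simp: mem_block)
    have 3: "\<not> ((x, y - 1) \<in> empties n D \<and> (x - 1, y) \<in> empties n D)"
      using tile st[of x "y - 1"] st[of "x - 1" y] st' unfolding aztec_odd[OF False] exactly_one4_def
      by (smt (verit))
    have "(x, y) \<in> aztec (Suc n) - covered ?P \<longleftrightarrow> (x, y - 1) \<in> empties n D \<or> (x - 1, y) \<in> empties n D"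
      using tile outside_cells[OF sub ev(1)] outside_cells[OF subP ev(1)] outside_cells[OF sub ev(2)] outside_cells[OF subP ev(2)]
        st[of x "y - 1"] st[of "x - 1" y] st'[of x "y - 1"] st'[of "x - 1" y]
        tiling_cell_disjoint[OF D, of x "y - 1"] tiling_cell_disjoint[OF D, of "x - 1" y]
      unfolding Diff_iff aztec_odd[OF False] exactly_one4_def mem_covered
      by (cases "(x, y - 1) \<in> cells n"; cases "(x - 1, y) \<in> cells n") (simp_all, argo+)
    with 2 3 no show ?thesis unfolding ex by blast
  qed
  then show "(x, y) \<in> aztec (Suc n) - covered ?P \<longleftrightarrow> (\<exists>s\<in>empties n D. (x, y) \<in> block s)"
    and "s \<in> empties n D \<Longrightarrow> t \<in> empties n D \<Longrightarrow> (x, y) \<in> block s \<Longrightarrow> (x, y) \<in> block t \<Longrightarrow> s = t"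
    by blast+
qed

lemma creation_blocks_slide_destroy:
  assumes D: "D \<in> tilings n"
  shows "creation_blocks (Suc n) (slide_destroy n D) = empties n D"
  unfolding creation_blocks_def
proof (rule the_equality)
  have "disjoint_family_on block (empties n D)"
    unfolding disjoint_family_on_def using tiling_slide_destroy_uncovered(2)[OF D] by (auto 0 4)
  moreover have union: "(\<Union>s\<in>empties n D. block s) = aztec (Suc n) - covered (slide_destroy n D)"
  proof (rule set_eqI)
    fix q :: sq
    obtain x y where "q = (x, y)" by (cases q)
    then show "q \<in> (\<Union>s\<in>empties n D. block s) \<longleftrightarrow> q \<in> aztec (Suc n) - covered (slide_destroy n D)"
      unfolding \<open>q = (x, y)\<close> tiling_slide_destroy_uncovered(1)[OF D] by blast
  qed
  ultimately show E: "disjoint_family_on block (empties n D) \<and>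
    (\<Union>s\<in>empties n D. block s) = aztec (Suc n) - covered (slide_destroy n D)" ..
  fix B assume "disjoint_family_on block B \<and> (\<Union>s\<in>B. block s) = aztec (Suc n) - covered (slide_destroy n D)"
  then show "B = empties n D"
    using E block_decomposition_unique[of B "empties n D"] finite_aztec[of "Suc n"] by auto
qed

section \<open>Weights and interactions cell by cell\<close>

lemma finite_cell_dominoes: "finite (cell_dominoes n)"
  unfolding cell_dominoes_def using finite_cells by simp

lemma prod_cell_dominoes:
  fixes f :: "domino \<Rightarrow> 'a :: comm_monoid_mult"
  assumes "D \<subseteq> cell_dominoes n"
  shows "prod f D = (\<Prod>s\<in>cells n. (if Hor s \<in> D then f (Hor s) else 1) *
    ((if Hor (nbr North s) \<in> D then f (Hor (nbr North s)) else 1) *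
    ((if Ver s \<in> D then f (Ver s) else 1) * (if Ver (nbr East s) \<in> D then f (Ver (nbr East s)) else 1))))"
proof -
  let ?C = "\<lambda>s. {Hor s, Hor (nbr North s), Ver s, Ver (nbr East s)}"
  have "prod f D = (\<Prod>d\<in>cell_dominoes n. if d \<in> D then f d else 1)"
    using assms finite_cell_dominoes by (simp add: prod.inter_restrict[symmetric] Int_absorb1)
  also have "\<dots> = (\<Prod>s\<in>cells n. \<Prod>d\<in>?C s. if d \<in> D then f d else 1)"
    unfolding cell_dominoes_def
  proof (rule prod.UNION_disjoint)
    show "\<forall>i\<in>cells n. \<forall>j\<in>cells n. i \<noteq> j \<longrightarrow> ?C i \<inter> ?C j = {}"
    proof (intro ballI impI)
      fix i j assume ij: "i \<in> cells n" "j \<in> cells n" "i \<noteq> j"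
      obtain x y where i: "i = (x, y)" by (cases i)
      obtain x' y' where j: "j = (x', y')" by (cases j)
      have "even (y - x + int n)" "even (y' - x' + int n)" using ij i j by (auto simp: mem_cells)
      then show "?C i \<inter> ?C j = {}" using ij(3) unfolding i j by auto
    qed
  qed (use finite_cells in auto)
  finally have "prod f D = (\<Prod>s\<in>cells n. \<Prod>d\<in>?C s. if d \<in> D then f d else 1)" .
  moreover have "(\<Prod>d\<in>?C s. if d \<in> D then f d else 1) = (if Hor s \<in> D then f (Hor s) else 1) *
    ((if Hor (nbr North s) \<in> D then f (Hor (nbr North s)) else 1) *
    ((if Ver s \<in> D then f (Ver s) else 1) * (if Ver (nbr East s) \<in> D then f (Ver (nbr East s)) else 1)))" for s
    by (cases s) simp
  ultimately show ?thesis by simp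
qed

definition cell_index :: "nat \<Rightarrow> sq \<Rightarrow> nat" where
  "cell_index n s = nat ((diag (Suc n) s + 1) div 2)"

lemma cell_index_cell:
  assumes "s \<in> cells n"
  obtains h where "0 \<le> h" "h \<le> int n" "diag n s = 2 * h" "cell_index n s = Suc (nat h)"
proof -
  obtain x y where s: "s = (x, y)" by (cases s)
  obtain h where h: "y - x + int n = 2 * h" using assms unfolding s mem_cells by blast
  moreover have "0 \<le> h" "h \<le> int n" using assms h unfolding s mem_cells by auto
  moreover have "(diag (Suc n) s + 1) div 2 = h + 1" using h by (simp add: s diag_def)
  ultimately show thesis using that[of h] unfolding cell_index_def s by (simp add: diag_def nat_add_distrib)
qed

lemma cell_index_range:
  assumes "s \<in> cells n"
  shows "cell_index n s \<in> {1..Suc n}"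
  using assms by (rule cell_index_cell) auto

text \<open>
  In rank \<open>n + 1\<close> the left square of the bottom domino of a cell is white, so this domino carries the weight \<open>c\<close>, while the
  top one carries the weight \<open>b\<close>.  In rank \<open>n\<close> the roles are exchanged, but the indices
  agree, so a slid domino keeps its weight.
\<close>

lemma tiling_weight_Suc_cells:
  assumes "D \<subseteq> cell_dominoes n"
  shows "tiling_weight b c (Suc n) D = (\<Prod>s\<in>cells n. (if Hor s \<in> D then c (cell_index n s) else 1) *
     (if Hor (nbr North s) \<in> D then b (Suc n - cell_index n s + 1) else 1))"
  unfolding tiling_weight_def prod_cell_dominoes[OF assms]
proof (rule prod.cong[OF refl])
  fix s assume s: "s \<in> cells n"
  obtain x y where xy: "s = (x, y)" by (cases s)
  have "odd (diag (Suc n) s)" "even (diag (Suc n) (nbr North s))"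
    "diag (Suc n) (nbr North s) div 2 = (diag (Suc n) s + 1) div 2"
    using s unfolding xy by (auto simp: mem_cells diag_def algebra_simps)
  then show "(if Hor s \<in> D then domino_weight b c (Suc n) (Hor s) else 1) *
      ((if Hor (nbr North s) \<in> D then domino_weight b c (Suc n) (Hor (nbr North s)) else 1) *
       ((if Ver s \<in> D then domino_weight b c (Suc n) (Ver s) else 1) *
        (if Ver (nbr East s) \<in> D then domino_weight b c (Suc n) (Ver (nbr East s)) else 1))) =
     (if Hor s \<in> D then c (cell_index n s) else 1) *
     (if Hor (nbr North s) \<in> D then b (Suc n - cell_index n s + 1) else 1)"
    by (simp add: cell_index_def)
qed

lemma tiling_weight_cells:
  assumes "D \<subseteq> cell_dominoes n"
  shows "tiling_weight b c n D = (\<Prod>s\<in>cells n. (if Hor (nbr North s) \<in> D then c (cell_index n s) else 1) *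
     (if Hor s \<in> D then b (Suc n - cell_index n s + 1) else 1))"
  unfolding tiling_weight_def prod_cell_dominoes[OF assms]
proof (rule prod.cong[OF refl])
  fix s assume s: "s \<in> cells n"
  obtain x y where xy: "s = (x, y)" by (cases s)
  have e: "odd (diag n (nbr North s))" "even (diag n s)" "diag n (nbr North s) = diag (Suc n) s"
    using s unfolding xy by (auto simp: mem_cells diag_def algebra_simps)
  have "n - nat (diag n s div 2) = Suc n - cell_index n s"
    using s by (rule cell_index_cell) simp
  note k = this
  have "domino_weight b c n (Hor s) = b (n - nat (diag n s div 2) + 1)" using e(2) by simp
  then have w1: "domino_weight b c n (Hor s) = b (Suc n - cell_index n s + 1)" unfolding k .
  have "domino_weight b c n (Hor (nbr North s)) = c (nat ((diag n (nbr North s) + 1) div 2))"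
    using e(1) by simp
  then have w2: "domino_weight b c n (Hor (nbr North s)) = c (cell_index n s)"
    unfolding e(3) cell_index_def .
  note w = w1 w2 domino_weight.simps(2)
  show "(if Hor s \<in> D then domino_weight b c n (Hor s) else 1) *
      ((if Hor (nbr North s) \<in> D then domino_weight b c n (Hor (nbr North s)) else 1) *
       ((if Ver s \<in> D then domino_weight b c n (Ver s) else 1) *
        (if Ver (nbr East s) \<in> D then domino_weight b c n (Ver (nbr East s)) else 1))) =
     (if Hor (nbr North s) \<in> D then c (cell_index n s) else 1) *
     (if Hor s \<in> D then b (Suc n - cell_index n s + 1) else 1)"
    unfolding w by simp
qed

lemma partner_dir_iff:
  assumes D: "D \<in> tilings r" and v: "(x, y) \<in> aztec r"
  shows "partner_dir D (x, y) = East \<longleftrightarrow> Hor (x, y) \<in> D"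
    and "partner_dir D (x, y) = North \<longleftrightarrow> Ver (x, y) \<in> D"
    and "partner_dir D (x, y) = West \<longleftrightarrow> Hor (x - 1, y) \<in> D"
    and "partner_dir D (x, y) = South \<longleftrightarrow> Ver (x, y - 1) \<in> D"
proof -
  have one: "exactly_one4 (Hor (x, y) \<in> D) (Hor (x - 1, y) \<in> D) (Ver (x, y) \<in> D) (Ver (x, y - 1) \<in> D)"
    using D v unfolding mem_tilings by presburger
  have sq: "squares d = {(x, y), nbr w (x, y)} \<longleftrightarrow> d = (case w of East \<Rightarrow> Hor (x, y) | North \<Rightarrow> Ver (x, y) |
      West \<Rightarrow> Hor (x - 1, y) | South \<Rightarrow> Ver (x, y - 1))" for d w
  proof (cases d)
    case (Hor s) then show ?thesis by (cases s; cases w) (auto simp: doubleton_eq_iff)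
  next
    case (Ver s) then show ?thesis by (cases s; cases w) (auto simp: doubleton_eq_iff)
  qed
  let ?Q = "\<lambda>w. (case w of East \<Rightarrow> Hor (x, y) | North \<Rightarrow> Ver (x, y) |
      West \<Rightarrow> Hor (x - 1, y) | South \<Rightarrow> Ver (x, y - 1)) \<in> D"
  have P: "partner_dir D (x, y) = (THE w. ?Q w)"
    unfolding partner_dir_def sq by (rule arg_cong[where f = The]) auto
  have ex1: "\<exists>!w. ?Q w"
  proof -
    have "?Q East \<or> ?Q West \<or> ?Q North \<or> ?Q South" using one by (auto simp: exactly_one4_def)
    moreover have "?Q u \<Longrightarrow> ?Q w \<Longrightarrow> u = w" for u w
      using one by (cases u; cases w) (auto simp: exactly_one4_def)
    ultimately show ?thesis by blast
  qed
  have iff: "partner_dir D (x, y) = w \<longleftrightarrow> ?Q w" for w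
    unfolding P using theI'[OF ex1] ex1 by blast
  show "partner_dir D (x, y) = East \<longleftrightarrow> Hor (x, y) \<in> D"
    "partner_dir D (x, y) = North \<longleftrightarrow> Ver (x, y) \<in> D"
    "partner_dir D (x, y) = West \<longleftrightarrow> Hor (x - 1, y) \<in> D"
    "partner_dir D (x, y) = South \<longleftrightarrow> Ver (x, y - 1) \<in> D"
    unfolding iff by simp_all
qed

lemma card_triples:
  assumes "finite A" "finite S"
  shows "card {(a, b, s). a \<in> A \<and> b \<in> A \<and> s \<in> S \<and> P a b s} =
    (\<Sum>s\<in>S. \<Sum>a\<in>A. \<Sum>b\<in>A. of_bool (P a b s))"
proof -
  have "{(a, b, s). a \<in> A \<and> b \<in> A \<and> s \<in> S \<and> P a b s} = {z \<in> A \<times> A \<times> S. P (fst z) (fst (snd z)) (snd (snd z))}"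
    by auto
  also have "card \<dots> = (\<Sum>z\<in>A \<times> A \<times> S. of_bool (P (fst z) (fst (snd z)) (snd (snd z))))"
    using assms by (simp add: sum.inter_filter[symmetric] of_bool_def)
  also have "\<dots> = (\<Sum>a\<in>A. \<Sum>b\<in>A. \<Sum>s\<in>S. of_bool (P a b s))"
    by (simp add: sum.cartesian_product split_def)
  also have "\<dots> = (\<Sum>a\<in>A. \<Sum>s\<in>S. \<Sum>b\<in>A. of_bool (P a b s))"
    by (rule sum.cong[OF refl], rule sum.swap)
  also have "\<dots> = (\<Sum>s\<in>S. \<Sum>a\<in>A. \<Sum>b\<in>A. of_bool (P a b s))"
    by (rule sum.swap)
  finally show ?thesis .
qed

lemma card_two_images:
  assumes "I = f ` X \<union> g ` Y" "f ` X \<inter> g ` Y = {}" "inj f" "inj g" "finite X" "finite Y"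
  shows "card I = card X + card Y"
  unfolding assms(1) using assms(2-) by (simp add: card_Un_disjoint card_image inj_on_subset)

text \<open>
  At a white square of rank \<open>n + 1\<close> the pairs of directions that interact are those with the first color
  going east and the second north or east, and those with the first color going north or east and
  the second west.  Such a square is the lower-left corner of a cell, from which it is covered when
  the direction is north or east, and the upper-right corner of another, from which it is covered
  when the direction is south or west.  The first kind is therefore visible in the former cell and
  the second kind in the latter.
\<close>

lemma card_interactions_Suc_cells:
  assumes T: "\<And>a. a \<in> {1..k} \<Longrightarrow> T a \<in> tilings (Suc n)"
  shows "card (interactions k (Suc n) T) = (\<Sum>s\<in>cells n. \<Sum>a\<in>{1..k}. \<Sum>b\<in>{1..k}.
     of_bool (a < b \<and> Hor s \<in> T a \<and> (Hor s \<in> T b \<or> Ver s \<in> T b)) +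
     of_bool (a < b \<and> Hor (nbr North s) \<in> T b \<and> \<not> (Hor (nbr North s) \<in> T a \<or> Ver (nbr East s) \<in> T a)))"
proof -
  define X where "X = {(a, b, s). a \<in> {1..k} \<and> b \<in> {1..k} \<and> s \<in> cells n \<and>
    (a < b \<and> Hor s \<in> T a \<and> (Hor s \<in> T b \<or> Ver s \<in> T b))}"
  define Y where "Y = {(a, b, s). a \<in> {1..k} \<and> b \<in> {1..k} \<and> s \<in> cells n \<and>
    (a < b \<and> Hor (nbr North s) \<in> T b \<and> \<not> (Hor (nbr North s) \<in> T a \<or> Ver (nbr East s) \<in> T a))}"
  \<comment> \<open>The interacting square is the upper-right corner of the cell.\<close>
  define g :: "nat \<times> nat \<times> sq \<Rightarrow> nat \<times> nat \<times> sq" where "g = (\<lambda>(a, b, x, y). (a, b, x + 1, y + 1))"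
  have fin: "finite X" "finite Y"
    by (rule finite_subset[of _ "{1..k} \<times> {1..k} \<times> cells n"]; auto simp: X_def Y_def finite_cells)+
  have gY: "(a, b, x, y) \<in> g ` Y \<longleftrightarrow> (a, b, x - 1, y - 1) \<in> Y" for a b x y
    unfolding g_def by force
  have main: "(a, b, x, y) \<in> interactions k (Suc n) T \<longleftrightarrow> (a, b, x, y) \<in> X \<or> (a, b, x - 1, y - 1) \<in> Y"
      "\<not> ((a, b, x, y) \<in> X \<and> (a, b, x - 1, y - 1) \<in> Y)" for a b x y
  proof -
    have "((a, b, x, y) \<in> interactions k (Suc n) T \<longleftrightarrow> (a, b, x, y) \<in> X \<or> (a, b, x - 1, y - 1) \<in> Y) \<and>
      \<not> ((a, b, x, y) \<in> X \<and> (a, b, x - 1, y - 1) \<in> Y)"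
    proof (cases "a \<in> {1..k} \<and> b \<in> {1..k} \<and> a < b \<and> even (y - x + int n) \<and> (x, y) \<in> aztec (Suc n)")
      case True
      then have ev: "even (y - x + int n)" and az: "(x, y) \<in> aztec (Suc n)" and ab: "a \<in> {1..k}" "b \<in> {1..k}" "a < b"
        by auto
      have ev': "even (y - 1 - (x - 1) + int n)" using ev by simp
      have Ta: "T a \<in> tilings (Suc n)" and Tb: "T b \<in> tilings (Suc n)" using T ab by auto
      have sub: "T a \<subseteq> cell_dominoes n" "T b \<subseteq> cell_dominoes n"
        using tiling_subset_cell_dominoes Ta Tb by blast+
      note da = partner_dir_iff[OF Ta az] and db = partner_dir_iff[OF Tb az]
      have one: "exactly_one4 (Hor (x, y) \<in> T a) (Hor (x - 1, y) \<in> T a) (Ver (x, y) \<in> T a) (Ver (x, y - 1) \<in> T a)"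
         "exactly_one4 (Hor (x, y) \<in> T b) (Hor (x - 1, y) \<in> T b) (Ver (x, y) \<in> T b) (Ver (x, y - 1) \<in> T b)"
        using Ta Tb az unfolding mem_tilings by presburger+
      show ?thesis
        using ab az ev one outside_cells[OF sub(1) ev] outside_cells[OF sub(2) ev]
          outside_cells[OF sub(1) ev'] outside_cells[OF sub(2) ev']
        unfolding X_def Y_def interactions_def
        by (simp add: da db diag_def exactly_one4_def) argo
    next
      case False
      have f: "white (Suc n) (x, y) \<longleftrightarrow> even (y - x + int n)" by (simp add: diag_def)
      have "even (y - x + int n) \<and> (x, y) \<in> aztec (Suc n)"
        if "(x, y) \<in> cells n \<or> (x - 1, y - 1) \<in> cells n"
        using that unfolding mem_cells mem_aztec by auto
      then show ?thesis
        using False unfolding X_def Y_def interactions_def mem_Collect_eq prod.case f by blast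
    qed
    then show "(a, b, x, y) \<in> interactions k (Suc n) T \<longleftrightarrow> (a, b, x, y) \<in> X \<or> (a, b, x - 1, y - 1) \<in> Y"
      "\<not> ((a, b, x, y) \<in> X \<and> (a, b, x - 1, y - 1) \<in> Y)" by blast+
  qed
  have "card (interactions k (Suc n) T) = card X + card Y"
  proof (rule card_two_images[of _ id _ g])
    have "(a, b, x, y) \<in> interactions k (Suc n) T \<longleftrightarrow> (a, b, x, y) \<in> id ` X \<union> g ` Y"
      "(a, b, x, y) \<notin> id ` X \<inter> g ` Y" for a b x y
      unfolding Un_iff Int_iff image_id id_apply gY main(1) using main(2) by blast+
    then show "interactions k (Suc n) T = id ` X \<union> g ` Y" "id ` X \<inter> g ` Y = {}"
      unfolding set_eq_iff split_paired_All empty_iff by blast+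
    show "inj g" by (auto simp: inj_def g_def)
  qed (use fin in auto)
  then show ?thesis
    unfolding X_def Y_def card_triples[OF finite_atLeastAtMost finite_cells] by (simp add: sum.distrib)
qed

text \<open>
  In rank \<open>n\<close> a white square is the upper-left corner of one cell, where its dominoes go east or south, and
  the lower-right corner of another, where they go north or west.  A first color going east
  interacts with every second color not going south, which is decided in the former cell; a first
  color going north interacts only with a second color going west, which is decided in the latter.
\<close>

lemma card_interactions_cells:
  assumes T: "\<And>a. a \<in> {1..k} \<Longrightarrow> T a \<in> tilings n"
  shows "card (interactions k n T) = (\<Sum>s\<in>cells n. \<Sum>a\<in>{1..k}. \<Sum>b\<in>{1..k}.
     of_bool (a < b \<and> Hor (nbr North s) \<in> T a \<and> Ver s \<notin> T b) +
     of_bool (a < b \<and> Ver (nbr East s) \<in> T a \<and> Hor s \<in> T b))"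
proof -
  define X where "X = {(a, b, s). a \<in> {1..k} \<and> b \<in> {1..k} \<and> s \<in> cells n \<and>
    (a < b \<and> Hor (nbr North s) \<in> T a \<and> Ver s \<notin> T b)}"
  define Y where "Y = {(a, b, s). a \<in> {1..k} \<and> b \<in> {1..k} \<and> s \<in> cells n \<and>
    (a < b \<and> Ver (nbr East s) \<in> T a \<and> Hor s \<in> T b)}"
  \<comment> \<open>The interacting square is the upper-left corner of the cell for \<open>f\<close> and the lower-right corner for \<open>g\<close>.\<close>
  define f :: "nat \<times> nat \<times> sq \<Rightarrow> nat \<times> nat \<times> sq" where "f = (\<lambda>(a, b, x, y). (a, b, x, y + 1))"
  define g :: "nat \<times> nat \<times> sq \<Rightarrow> nat \<times> nat \<times> sq" where "g = (\<lambda>(a, b, x, y). (a, b, x + 1, y))"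
  have fin: "finite X" "finite Y"
    by (rule finite_subset[of _ "{1..k} \<times> {1..k} \<times> cells n"]; auto simp: X_def Y_def finite_cells)+
  have fX: "(a, b, x, y) \<in> f ` X \<longleftrightarrow> (a, b, x, y - 1) \<in> X" for a b x y
    unfolding f_def by force
  have gY: "(a, b, x, y) \<in> g ` Y \<longleftrightarrow> (a, b, x - 1, y) \<in> Y" for a b x y
    unfolding g_def by force
  have main: "(a, b, x, y) \<in> interactions k n T \<longleftrightarrow> (a, b, x, y - 1) \<in> X \<or> (a, b, x - 1, y) \<in> Y"
      "\<not> ((a, b, x, y - 1) \<in> X \<and> (a, b, x - 1, y) \<in> Y)" for a b x y
  proof -
    have "((a, b, x, y) \<in> interactions k n T \<longleftrightarrow> (a, b, x, y - 1) \<in> X \<or> (a, b, x - 1, y) \<in> Y) \<and>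
      \<not> ((a, b, x, y - 1) \<in> X \<and> (a, b, x - 1, y) \<in> Y)"
    proof (cases "a \<in> {1..k} \<and> b \<in> {1..k} \<and> a < b \<and> odd (y - x + int n)")
      case True
      then have od: "odd (y - x + int n)" and ab: "a \<in> {1..k}" "b \<in> {1..k}" "a < b"
        by auto
      have ev: "even (y - 1 - x + int n)" "even (y - (x - 1) + int n)" using od by presburger+
      have Ta: "T a \<in> tilings n" and Tb: "T b \<in> tilings n" using T ab by auto
      have sub: "T a \<subseteq> cell_dominoes n" "T b \<subseteq> cell_dominoes n"
        using tiling_subset_cell_dominoes Ta Tb by blast+
      show ?thesis
      proof (cases "(x, y) \<in> aztec n")
        case az: True
        note da = partner_dir_iff[OF Ta az] and db = partner_dir_iff[OF Tb az]
        have one: "exactly_one4 (Hor (x, y) \<in> T a) (Hor (x - 1, y) \<in> T a) (Ver (x, y) \<in> T a) (Ver (x, y - 1) \<in> T a)"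
           "exactly_one4 (Hor (x, y) \<in> T b) (Hor (x - 1, y) \<in> T b) (Ver (x, y) \<in> T b) (Ver (x, y - 1) \<in> T b)"
          using Ta Tb az unfolding mem_tilings by presburger+
        show ?thesis
          using ab az od one aztec_odd(2)[OF od]
          unfolding X_def Y_def interactions_def
          by (simp add: da db diag_def exactly_one4_def) argo
      next
        case az: False
        have none: "Hor (x, y) \<notin> T a \<and> Hor (x - 1, y) \<notin> T a \<and> Ver (x, y) \<notin> T a \<and> Ver (x, y - 1) \<notin> T a"
          using Ta az unfolding mem_tilings by presburger
        then show ?thesis using az unfolding X_def Y_def interactions_def by simp
      qed
    next
      case False
      then show ?thesis unfolding X_def Y_def interactions_def
        by (auto simp: diag_def mem_cells)
    qed
    then show "(a, b, x, y) \<in> interactions k n T \<longleftrightarrow> (a, b, x, y - 1) \<in> X \<or> (a, b, x - 1, y) \<in> Y"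
      "\<not> ((a, b, x, y - 1) \<in> X \<and> (a, b, x - 1, y) \<in> Y)" by blast+
  qed
  have "card (interactions k n T) = card X + card Y"
  proof (rule card_two_images[of _ f _ g])
    have "(a, b, x, y) \<in> interactions k n T \<longleftrightarrow> (a, b, x, y) \<in> f ` X \<union> g ` Y"
      "(a, b, x, y) \<notin> f ` X \<inter> g ` Y" for a b x y
      unfolding Un_iff Int_iff fX gY main(1) using main(2) by blast+
    then show "interactions k n T = f ` X \<union> g ` Y" "f ` X \<inter> g ` Y = {}"
      unfolding set_eq_iff split_paired_All empty_iff by blast+
    show "inj f" "inj g" by (auto simp: inj_def f_def g_def)
  qed (use fin in auto)
  then show ?thesis
    unfolding X_def Y_def card_triples[OF finite_atLeastAtMost finite_cells] by (simp add: sum.distrib)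
qed

section \<open>Exchange of weights under the spider move\<close>

definition ll_covered :: "domino set \<Rightarrow> sq \<Rightarrow> bool" where
  "ll_covered D s \<longleftrightarrow> Hor s \<in> D \<or> Ver s \<in> D"

definition ur_covered :: "domino set \<Rightarrow> sq \<Rightarrow> bool" where
  "ur_covered D s \<longleftrightarrow> Hor (nbr North s) \<in> D \<or> Ver (nbr East s) \<in> D"

definition cell_weight :: "(nat \<Rightarrow> real) \<Rightarrow> (nat \<Rightarrow> real) \<Rightarrow> nat \<Rightarrow> sq \<Rightarrow> real" where
  "cell_weight b c n s = c (cell_index n s) * b (Suc n - cell_index n s + 1)"

text \<open>
  Here \<open>T\<close> is the \<open>k\<close>-tiling after the move.  Only coverage enters, so all \<open>k\<close>-tilings with the same slid
  part give the same value.
\<close>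

definition interaction_exponent :: "nat \<Rightarrow> (nat \<Rightarrow> domino set) \<Rightarrow> nat \<Rightarrow> sq \<Rightarrow> nat" where
  "interaction_exponent k T a s = card {m \<in> {1..k}. m < a \<and> \<not> ur_covered (T m) s} +
     card {m \<in> {1..k}. a < m \<and> ll_covered (T m) s}"

lemma swap_states_cases:
  assumes "swap_states (B, T, L, R) (B', T', L', R')"
  shows "(B, T, L, R, B', T', L', R') \<in>
    {(False, False, False, False, True, True, False, False),
     (False, False, False, False, False, False, True, True),
     (True, True, False, False, False, False, False, False),
     (False, False, True, True, False, False, False, False),
     (True, False, False, False, False, True, False, False),
     (False, True, False, False, True, False, False, False),
     (False, False, True, False, False, False, False, True),
     (False, False, False, True, False, False, True, False)}"
  using assms unfolding swap_states.simps exactly_one4_def insert_iff empty_iff prod.inject simp_thms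
  by argo

text \<open>
  The interactions of two colors inside one cell, the first color being the smaller one.  The two
  counts agree once created horizontal pairs are credited to the old rank and destroyed ones to the
  new rank.
\<close>

lemma interaction_exchange_pair:
  assumes "swap_states (B1, T1, L1, R1) (B1', T1', L1', R1')"
    and "swap_states (B2, T2, L2, R2) (B2', T2', L2', R2')"
  shows "of_bool (T1 \<and> \<not> L2) + of_bool (R1 \<and> B2) +
      of_bool (\<not> B2 \<and> \<not> T2 \<and> \<not> L2 \<and> \<not> R2 \<and> B2' \<and> \<not> (T1' \<or> R1')) +
      of_bool (\<not> B1 \<and> \<not> T1 \<and> \<not> L1 \<and> \<not> R1 \<and> B1' \<and> (B2' \<or> L2')) =
    (of_bool (B1' \<and> (B2' \<or> L2')) + of_bool (T2' \<and> \<not> (T1' \<or> R1')) +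
      of_bool (\<not> B2' \<and> \<not> T2' \<and> \<not> L2' \<and> \<not> R2' \<and> B2 \<and> \<not> (T1' \<or> R1')) +
      of_bool (\<not> B1' \<and> \<not> T1' \<and> \<not> L1' \<and> \<not> R1' \<and> B1 \<and> (B2' \<or> L2')) :: nat)"
  using swap_states_cases[OF assms(1)] swap_states_cases[OF assms(2)]
  unfolding insert_iff empty_iff prod.inject
  by (elim disjE conjE FalseE) simp_all

lemma interaction_exponent_eq_sum:
  "interaction_exponent k T a s = (\<Sum>m\<in>{1..k}. of_bool (m < a \<and> \<not> ur_covered (T m) s) + of_bool (a < m \<and> ll_covered (T m) s))"
  unfolding interaction_exponent_def sum.distrib by (simp add: Int_def)

text \<open>
  The contribution of smaller colors is rewritten so that each unordered pair of colors appears with the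
  smaller one first, as in the count of interactions.
\<close>

lemma sum_interaction_exponent_swap:
  "(\<Sum>a\<in>{1..k}. of_bool (P a) * interaction_exponent k T a s) = (\<Sum>a\<in>{1..k}. \<Sum>m\<in>{1..k}.
     of_bool (P m \<and> a < m \<and> \<not> ur_covered (T a) s) + of_bool (P a \<and> a < m \<and> ll_covered (T m) s))"
proof -
  have "(\<Sum>a\<in>{1..k}. of_bool (P a) * interaction_exponent k T a s) =
      (\<Sum>a\<in>{1..k}. \<Sum>m\<in>{1..k}. of_bool (P a \<and> m < a \<and> \<not> ur_covered (T m) s)) +
      (\<Sum>a\<in>{1..k}. \<Sum>m\<in>{1..k}. of_bool (P a \<and> a < m \<and> ll_covered (T m) s))"
    unfolding interaction_exponent_eq_sum sum_distrib_left sum.distrib[symmetric]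
    by (intro sum.cong refl) (auto simp: of_bool_def)
  also have "(\<Sum>a\<in>{1..k}. \<Sum>m\<in>{1..k}. of_bool (P a \<and> m < a \<and> \<not> ur_covered (T m) s)) =
      (\<Sum>a\<in>{1..k}. \<Sum>m\<in>{1..k}. of_bool (P m \<and> a < m \<and> \<not> ur_covered (T a) s) :: nat)"
    by (rule sum.swap)
  finally show ?thesis by (simp add: sum.distrib)
qed

lemma interaction_exchange:
  assumes D: "\<And>a. a \<in> {1..k} \<Longrightarrow> D a \<in> tilings n"
    and D': "\<And>a. a \<in> {1..k} \<Longrightarrow> D' a \<in> tilings (Suc n)"
    and sp: "\<And>a. a \<in> {1..k} \<Longrightarrow> spider n (D a) (D' a)"
  shows "card (interactions k n D) +
      (\<Sum>a\<in>{1..k}. \<Sum>s\<in>empties n (D a). of_bool (Hor s \<in> D' a) * interaction_exponent k D' a s) =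
    card (interactions k (Suc n) D') +
      (\<Sum>a\<in>{1..k}. \<Sum>s\<in>empties n (D' a). of_bool (Hor s \<in> D a) * interaction_exponent k D' a s)"
proof -
  have conv: "(\<Sum>a\<in>{1..k}. \<Sum>s\<in>empties n (X a). of_bool (Hor s \<in> Y a) * interaction_exponent k D' a s) =
    (\<Sum>s\<in>cells n. \<Sum>a\<in>{1..k}. of_bool (s \<in> empties n (X a) \<and> Hor s \<in> Y a) * interaction_exponent k D' a s)"
    for X Y
  proof -
    have "(\<Sum>s\<in>empties n (X a). of_bool (Hor s \<in> Y a) * interaction_exponent k D' a s) =
        (\<Sum>s\<in>cells n. of_bool (s \<in> empties n (X a) \<and> Hor s \<in> Y a) * interaction_exponent k D' a s)" for a
      by (rule sum.mono_neutral_cong_left) (use empties_subset finite_cells in auto)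
    then show ?thesis by (simp add: sum.swap[of _ "cells n"])
  qed
  have old: "card (interactions k n D) = (\<Sum>s\<in>cells n. \<Sum>a\<in>{1..k}. \<Sum>b\<in>{1..k}.
     of_bool (a < b \<and> Hor (nbr North s) \<in> D a \<and> Ver s \<notin> D b) +
     of_bool (a < b \<and> Ver (nbr East s) \<in> D a \<and> Hor s \<in> D b))"
    by (rule card_interactions_cells) (fact D)
  have new: "card (interactions k (Suc n) D') = (\<Sum>s\<in>cells n. \<Sum>a\<in>{1..k}. \<Sum>b\<in>{1..k}.
     of_bool (a < b \<and> Hor s \<in> D' a \<and> (Hor s \<in> D' b \<or> Ver s \<in> D' b)) +
     of_bool (a < b \<and> Hor (nbr North s) \<in> D' b \<and> \<not> (Hor (nbr North s) \<in> D' a \<or> Ver (nbr East s) \<in> D' a)))"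
    by (rule card_interactions_Suc_cells) (fact D')
  show ?thesis
    unfolding conv old new sum_interaction_exponent_swap sum.distrib[symmetric]
  proof (intro sum.cong refl)
    fix s a m assume s: "s \<in> cells n" and a: "a \<in> {1..k}" and m: "m \<in> {1..k}"
    show "of_bool (a < m \<and> Hor (nbr North s) \<in> D a \<and> Ver s \<notin> D m) +
       of_bool (a < m \<and> Ver (nbr East s) \<in> D a \<and> Hor s \<in> D m) +
       (of_bool ((s \<in> empties n (D m) \<and> Hor s \<in> D' m) \<and> a < m \<and> \<not> ur_covered (D' a) s) +
        of_bool ((s \<in> empties n (D a) \<and> Hor s \<in> D' a) \<and> a < m \<and> ll_covered (D' m) s)) =
       (of_bool (a < m \<and> Hor s \<in> D' a \<and> (Hor s \<in> D' m \<or> Ver s \<in> D' m)) +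
       of_bool (a < m \<and> Hor (nbr North s) \<in> D' m \<and> \<not> (Hor (nbr North s) \<in> D' a \<or> Ver (nbr East s) \<in> D' a)) +
       (of_bool ((s \<in> empties n (D' m) \<and> Hor s \<in> D m) \<and> a < m \<and> \<not> ur_covered (D' a) s) +
        of_bool ((s \<in> empties n (D' a) \<and> Hor s \<in> D a) \<and> a < m \<and> ll_covered (D' m) s)) :: nat)"
      using interaction_exchange_pair[OF spider_state[OF sp[OF a] s] spider_state[OF sp[OF m] s]] s
      by (cases "a < m") (simp_all add: empties_def ur_covered_def ll_covered_def)
  qed
qed

lemma domino_weight_exchange:
  assumes sp: "spider n D D'"
  shows "tiling_weight b c n D * (\<Prod>s\<in>empties n D. if Hor s \<in> D' then cell_weight b c n s else 1) =
    tiling_weight b c (Suc n) D' * (\<Prod>s\<in>empties n D'. if Hor s \<in> D then cell_weight b c n s else 1)"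
proof -
  have sub: "D \<subseteq> cell_dominoes n" "D' \<subseteq> cell_dominoes n" using sp by (auto simp: spider_def)
  have conv: "(\<Prod>s\<in>empties n X. if Hor s \<in> Y then cell_weight b c n s else 1) =
    (\<Prod>s\<in>cells n. if s \<in> empties n X \<and> Hor s \<in> Y then cell_weight b c n s else 1)" for X Y
    by (rule prod.mono_neutral_cong_left) (use empties_subset finite_cells in auto)
  show ?thesis
    unfolding conv tiling_weight_cells[OF sub(1)] tiling_weight_Suc_cells[OF sub(2)] prod.distrib[symmetric]
  proof (rule prod.cong[OF refl])
    fix s assume s: "s \<in> cells n"
    show "(if Hor (nbr North s) \<in> D then c (cell_index n s) else 1) *
       (if Hor s \<in> D then b (Suc n - cell_index n s + 1) else 1) *
       (if s \<in> empties n D \<and> Hor s \<in> D' then cell_weight b c n s else 1) =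
      (if Hor s \<in> D' then c (cell_index n s) else 1) *
       (if Hor (nbr North s) \<in> D' then b (Suc n - cell_index n s + 1) else 1) *
       (if s \<in> empties n D' \<and> Hor s \<in> D then cell_weight b c n s else 1)"
      using swap_states_cases[OF spider_state[OF sp s]] s
      unfolding empties_def insert_iff empty_iff prod.inject mem_Collect_eq
      by (elim disjE conjE FalseE) (simp_all add: cell_weight_def)
  qed
qed

text \<open>
  Detailed balance: the weight of the old \<open>k\<close>-tiling times the horizontal factors of the created pairs
  equals the weight of the new one times the horizontal factors of the destroyed pairs.
\<close>

lemma weight_exchange:
  assumes D: "D \<in> ktilings k n" and D': "D' \<in> ktilings k (Suc n)"
    and sp: "\<And>a. a \<in> {1..k} \<Longrightarrow> spider n (D a) (D' a)"
  shows "ktiling_weight b c t k n D * (\<Prod>a\<in>{1..k}. \<Prod>s\<in>empties n (D a).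
        if Hor s \<in> D' a then cell_weight b c n s * t ^ interaction_exponent k D' a s else 1) =
    ktiling_weight b c t k (Suc n) D' * (\<Prod>a\<in>{1..k}. \<Prod>s\<in>empties n (D' a).
        if Hor s \<in> D a then cell_weight b c n s * t ^ interaction_exponent k D' a s else 1)"
proof -
  have split: "(\<Prod>a\<in>{1..k}. \<Prod>s\<in>empties n (X a).
        if Hor s \<in> Y a then cell_weight b c n s * t ^ interaction_exponent k D' a s else 1) =
     (\<Prod>a\<in>{1..k}. \<Prod>s\<in>empties n (X a). if Hor s \<in> Y a then cell_weight b c n s else 1) *
     t ^ (\<Sum>a\<in>{1..k}. \<Sum>s\<in>empties n (X a). of_bool (Hor s \<in> Y a) * interaction_exponent k D' a s)" for X Y
    unfolding power_sum prod.distrib[symmetric] by (intro prod.cong refl) simp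
  have mem: "D a \<in> tilings n" "D' a \<in> tilings (Suc n)" if "a \<in> {1..k}" for a
    using D D' that unfolding ktilings_def by (auto simp: PiE_iff)
  have dom: "(\<Prod>a\<in>{1..k}. tiling_weight b c n (D a)) *
      (\<Prod>a\<in>{1..k}. \<Prod>s\<in>empties n (D a). if Hor s \<in> D' a then cell_weight b c n s else 1) =
    (\<Prod>a\<in>{1..k}. tiling_weight b c (Suc n) (D' a)) *
      (\<Prod>a\<in>{1..k}. \<Prod>s\<in>empties n (D' a). if Hor s \<in> D a then cell_weight b c n s else 1)"
    unfolding prod.distrib[symmetric] by (intro prod.cong refl domino_weight_exchange sp)
  have pow: "t ^ card (interactions k n D) *
      t ^ (\<Sum>a\<in>{1..k}. \<Sum>s\<in>empties n (D a). of_bool (Hor s \<in> D' a) * interaction_exponent k D' a s) =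
    t ^ card (interactions k (Suc n) D') *
      t ^ (\<Sum>a\<in>{1..k}. \<Sum>s\<in>empties n (D' a). of_bool (Hor s \<in> D a) * interaction_exponent k D' a s)"
    unfolding power_add[symmetric]
    by (rule arg_cong[where f = "\<lambda>e. t ^ e"], rule interaction_exchange) (use mem sp in auto)
  have "(p1 * w1) * (q1 * r1) = (p2 * w2) * (q2 * r2)"
    if "w1 * q1 = w2 * q2" "p1 * r1 = p2 * r2" for p1 p2 w1 w2 q1 q2 r1 r2 :: real
  proof -
    have "(p1 * w1) * (q1 * r1) = (w1 * q1) * (p1 * r1)" by simp
    also have "\<dots> = (p2 * w2) * (q2 * r2)" unfolding that by simp
    finally show ?thesis .
  qed
  from this[OF dom pow] show ?thesis unfolding ktiling_weight_def split .
qed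

lemma finite_tilings: "finite (tilings n)"
proof (rule finite_subset)
  show "tilings n \<subseteq> Pow (cell_dominoes n)" using tiling_subset_cell_dominoes by blast
qed (simp add: finite_cell_dominoes)

lemma finite_ktilings: "finite (ktilings k n)"
  unfolding ktilings_def using finite_tilings by (intro finite_PiE) auto

lemma finite_empties: "finite (empties n D)"
  using finite_subset[OF empties_subset finite_cells] .

lemma refill_cong:
  assumes "\<And>s. s \<in> empties n D \<Longrightarrow> h s = h' s"
  shows "refill n D h = refill n D h'"
  using assms unfolding refill_def by auto

text \<open>
  The predecessors of a tiling correspond to the sets of empty cells that receive a horizontal pair,
  and the sum over these sets is the expansion of the product.
\<close>

lemma sum_predecessors:
  fixes y :: "sq \<Rightarrow> real"
  assumes Y: "Y \<in> tilings (Suc n)"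
  shows "(\<Sum>X\<in>{X \<in> tilings n. spider n X Y}. \<Prod>s\<in>empties n Y. if Hor s \<in> X then y s else 1) =
    (\<Prod>s\<in>empties n Y. 1 + y s)"
proof -
  have "(\<Prod>s\<in>empties n Y. 1 + y s) = (\<Prod>s\<in>empties n Y. y s + 1)" by (simp add: add.commute)
  also have "\<dots> = (\<Sum>J\<in>Pow (empties n Y). (\<Prod>s\<in>J. y s) * (\<Prod>s\<in>empties n Y - J. 1))"
    by (rule prod_add[OF finite_empties])
  also have "\<dots> = (\<Sum>X\<in>{X \<in> tilings n. spider n X Y}. \<Prod>s\<in>empties n Y. if Hor s \<in> X then y s else 1)"
  proof (rule sum.reindex_bij_witness[of _ "\<lambda>X. {s \<in> empties n Y. Hor s \<in> X}" "\<lambda>J. refill n Y (\<lambda>s. s \<in> J)"])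
    fix J assume J: "J \<in> Pow (empties n Y)"
    then show "{s \<in> empties n Y. Hor s \<in> refill n Y (\<lambda>s. s \<in> J)} = J"
      by (auto simp: Hor_mem_refill)
    have "spider n (refill n Y (\<lambda>s. s \<in> J)) Y"
      using spider_refill[of Y n] Y spider_sym by blast
    then show "refill n Y (\<lambda>s. s \<in> J) \<in> {X \<in> tilings n. spider n X Y}"
      using spider_tilings_iff Y by blast
    have "(\<Prod>s\<in>empties n Y. if Hor s \<in> refill n Y (\<lambda>s. s \<in> J) then y s else 1) =
        (\<Prod>s\<in>empties n Y. if s \<in> J then y s else 1)"
      by (intro prod.cong refl) (simp add: Hor_mem_refill)
    also have "\<dots> = (\<Prod>s\<in>J. y s)"
      using J finite_empties by (simp add: prod.inter_restrict[symmetric] Int_absorb1)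
    finally show "(\<Prod>s\<in>empties n Y. if Hor s \<in> refill n Y (\<lambda>s. s \<in> J) then y s else 1) =
        (\<Prod>s\<in>J. y s) * (\<Prod>s\<in>empties n Y - J. 1)" by simp
  next
    fix X assume X: "X \<in> {X \<in> tilings n. spider n X Y}"
    then have "X = refill n Y (\<lambda>s. Hor s \<in> X)"
      using spider_imp_refill spider_sym by blast
    also have "\<dots> = refill n Y (\<lambda>s. s \<in> {s \<in> empties n Y. Hor s \<in> X})"
      by (rule refill_cong) simp
    finally show "refill n Y (\<lambda>s. s \<in> {s \<in> empties n Y. Hor s \<in> X}) = X" by simp
  qed auto
  finally show ?thesis by simp
qed

lemma sum_predecessor_ktilings:
  fixes y :: "nat \<Rightarrow> sq \<Rightarrow> real"
  assumes D': "D' \<in> ktilings k (Suc n)"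
  shows "(\<Sum>D\<in>{D \<in> ktilings k n. \<forall>a\<in>{1..k}. spider n (D a) (D' a)}. \<Prod>a\<in>{1..k}. \<Prod>s\<in>empties n (D' a).
       if Hor s \<in> D a then y a s else 1) = (\<Prod>a\<in>{1..k}. \<Prod>s\<in>empties n (D' a). 1 + y a s)"
proof -
  have eq: "{D \<in> ktilings k n. \<forall>a\<in>{1..k}. spider n (D a) (D' a)} =
     (\<Pi>\<^sub>E a\<in>{1..k}. {X \<in> tilings n. spider n X (D' a)})"
    unfolding ktilings_def by (rule set_eqI) (simp only: PiE_iff mem_Collect_eq, blast)
  have "(\<Prod>a\<in>{1..k}. \<Prod>s\<in>empties n (D' a). 1 + y a s) =
     (\<Prod>a\<in>{1..k}. \<Sum>X\<in>{X \<in> tilings n. spider n X (D' a)}. \<Prod>s\<in>empties n (D' a). if Hor s \<in> X then y a s else 1)"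
    using D' by (intro prod.cong refl sum_predecessors[symmetric]) (auto simp: ktilings_def PiE_iff)
  also have "\<dots> = (\<Sum>D\<in>(\<Pi>\<^sub>E a\<in>{1..k}. {X \<in> tilings n. spider n X (D' a)}). \<Prod>a\<in>{1..k}. \<Prod>s\<in>empties n (D' a).
       if Hor s \<in> D a then y a s else 1)"
    by (rule prod_sum_PiE) (auto simp: finite_tilings)
  finally show ?thesis unfolding eq by simp
qed

section \<open>Telescoping along a diagonal\<close>

text \<open>
  Turn \<open>S\<close> into \<open>S'\<close> by deciding the membership of the colors \<open>1, 2, \<dots>\<close> one at a time.  When the color \<open>a\<close> is
  processed, \<open>e a\<close> is the number of other colors in the current set.  A color that leaves takes the
  size from \<open>e a + 1\<close> to \<open>e a\<close>, a color that enters takes it from \<open>e a\<close> to \<open>e a + 1\<close>; either way the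
  product of \<open>F\<close> over the numbers below the size changes by the factor \<open>F (e a)\<close>.
\<close>

lemma hybrid_exchange:
  fixes F :: "nat \<Rightarrow> real" and S S' :: "nat set"
  assumes S: "S \<subseteq> {1..k}" "S' \<subseteq> {1..k}" and "l \<le> k"
  defines "e \<equiv> \<lambda>a. card {m \<in> {1..k}. m < a \<and> m \<in> S'} + card {m \<in> {1..k}. a < m \<and> m \<in> S}"
  defines "U \<equiv> \<lambda>l. {m \<in> S'. m \<le> l} \<union> {m \<in> S. l < m}"
  shows "(\<Prod>a\<in>{a \<in> S - S'. a \<le> l}. F (e a)) * prod F {..<card (U l)} =
    (\<Prod>a\<in>{a \<in> S' - S. a \<le> l}. F (e a)) * prod F {..<card S}"
  using \<open>l \<le> k\<close>
proof (induction l)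
  case 0
  have "{a \<in> S - S'. a \<le> 0} = {}" "{a \<in> S' - S. a \<le> 0} = {}" "U 0 = S"
    using S by (force simp: U_def)+
  then show ?case by (simp only: prod.empty)
next
  case (Suc l)
  then have IH: "(\<Prod>a\<in>{a \<in> S - S'. a \<le> l}. F (e a)) * prod F {..<card (U l)} =
    (\<Prod>a\<in>{a \<in> S' - S. a \<le> l}. F (e a)) * prod F {..<card S}" by simp
  have fin: "finite S" "finite S'" using S finite_subset by blast+
  let ?a = "Suc l"
  \<comment> \<open>The current set without the color being processed.\<close>
  define V where "V = {m \<in> {1..k}. m < ?a \<and> m \<in> S'} \<union> {m \<in> {1..k}. ?a < m \<and> m \<in> S}"
  have V: "finite V" "?a \<notin> V" "card V = e ?a"
    unfolding V_def e_def by (auto intro!: card_Un_disjoint)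
  have U: "U l = (if ?a \<in> S then insert ?a V else V)" "U (Suc l) = (if ?a \<in> S' then insert ?a V else V)"
  proof -
    have "x \<in> U l \<longleftrightarrow> x \<in> (if ?a \<in> S then insert ?a V else V)"
      "x \<in> U (Suc l) \<longleftrightarrow> x \<in> (if ?a \<in> S' then insert ?a V else V)" for x
      using S unfolding U_def V_def by (cases x ?a rule: linorder_cases; auto)+
    then show "U l = (if ?a \<in> S then insert ?a V else V)" "U (Suc l) = (if ?a \<in> S' then insert ?a V else V)"
      by blast+
  qed
  have A: "{a \<in> A. a \<le> Suc l} = (if ?a \<in> A then insert ?a {a \<in> A. a \<le> l} else {a \<in> A. a \<le> l})" for A
    by (auto simp: le_Suc_eq)
  have *: "(\<Prod>a\<in>{a \<in> A. a \<le> Suc l}. F (e a)) = (if ?a \<in> A then F (e ?a) else 1) * (\<Prod>a\<in>{a \<in> A. a \<le> l}. F (e a))"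
    if "finite A" for A unfolding A using that by simp
  show ?case
    using IH V fin unfolding U *[OF finite_Diff[OF fin(1)]] *[OF finite_Diff[OF fin(2)]]
    by (cases "?a \<in> S"; cases "?a \<in> S'") (simp_all add: mult_ac)
qed

lemma chain_exchange:
  fixes F :: "nat \<Rightarrow> real" and S S' :: "nat set"
  assumes S: "S \<subseteq> {1..k}" "S' \<subseteq> {1..k}"
  defines "e \<equiv> \<lambda>a. card {m \<in> {1..k}. m < a \<and> m \<in> S'} + card {m \<in> {1..k}. a < m \<and> m \<in> S}"
  shows "(\<Prod>a\<in>S - S'. F (e a)) * prod F {..<card S'} = (\<Prod>a\<in>S' - S. F (e a)) * prod F {..<card S}"
proof -
  have "{a \<in> S - S'. a \<le> k} = S - S'" "{a \<in> S' - S. a \<le> k} = S' - S"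
     "{m \<in> S'. m \<le> k} \<union> {m \<in> S. k < m} = S'"
    using S by auto
  with hybrid_exchange[OF S order_refl, of F] show ?thesis unfolding e_def by simp
qed

lemma chain_telescope:
  fixes F :: "nat \<Rightarrow> real" and S :: "nat \<Rightarrow> nat set"
  assumes S: "\<And>j. j \<le> n \<Longrightarrow> S j \<subseteq> {1..k}"
  defines "e \<equiv> \<lambda>j a. card {m \<in> {1..k}. m < a \<and> m \<in> S (Suc j)} + card {m \<in> {1..k}. a < m \<and> m \<in> S j}"
  shows "(\<Prod>j<n. \<Prod>a\<in>S j - S (Suc j). F (e j a)) * prod F {..<card (S n)} =
    (\<Prod>j<n. \<Prod>a\<in>S (Suc j) - S j. F (e j a)) * prod F {..<card (S 0)}"
  using S
proof (induction n)
  case 0 then show ?case by simp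
next
  case (Suc n)
  let ?L = "\<lambda>j. \<Prod>a\<in>S j - S (Suc j). F (e j a)" and ?R = "\<lambda>j. \<Prod>a\<in>S (Suc j) - S j. F (e j a)"
  let ?Q = "\<lambda>j. prod F {..<card (S j)}"
  have step: "?L n * ?Q (Suc n) = ?R n * ?Q n"
    unfolding e_def by (rule chain_exchange) (use Suc.prems in auto)
  have IH: "(\<Prod>j<n. ?L j) * ?Q n = (\<Prod>j<n. ?R j) * ?Q 0" using Suc by simp
  have "(\<Prod>j<Suc n. ?L j) * ?Q (Suc n) = (\<Prod>j<n. ?L j) * (?L n * ?Q (Suc n))" by simp
  also have "\<dots> = ((\<Prod>j<n. ?L j) * ?Q n) * ?R n" unfolding step by simp
  also have "\<dots> = (\<Prod>j<Suc n. ?R j) * ?Q 0" unfolding IH by simp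
  finally show ?case .
qed

text \<open>
  The cell number \<open>j\<close> on the diagonal number \<open>i\<close>, counted from the lower left; both run through \<open>{0..n}\<close>.
  The lower-left square of each cell is the upper-right square of the preceding one.
\<close>

definition grid_cell :: "nat \<Rightarrow> nat \<Rightarrow> nat \<Rightarrow> sq" where
  "grid_cell n i j = (int j - int i - 1, int i + int j - int n - 1)"

lemma cells_eq_grid: "cells n = (\<lambda>(i, j). grid_cell n i j) ` ({..n} \<times> {..n})"
proof -
  have "(x, y) \<in> cells n \<longleftrightarrow> (x, y) \<in> (\<lambda>(i, j). grid_cell n i j) ` ({..n} \<times> {..n})" for x y
  proof
    assume xy: "(x, y) \<in> cells n"
    then obtain h where h: "y - x + int n = 2 * h" unfolding mem_cells by blast
    then have "0 \<le> h" "h \<le> int n" "0 \<le> x + 1 + h" "x + 1 + h \<le> int n"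
      using xy by (auto simp: mem_cells)
    with h show "(x, y) \<in> (\<lambda>(i, j). grid_cell n i j) ` ({..n} \<times> {..n})"
      by (intro rev_image_eqI[of "(nat h, nat (x + 1 + h))"]) (auto simp: grid_cell_def nat_le_iff)
  next
    assume "(x, y) \<in> (\<lambda>(i, j). grid_cell n i j) ` ({..n} \<times> {..n})"
    then show "(x, y) \<in> cells n" by (auto simp: grid_cell_def mem_cells)
  qed
  then show ?thesis unfolding set_eq_iff split_paired_All by blast
qed

lemma grid_cell_mem: "i \<le> n \<Longrightarrow> j \<le> n \<Longrightarrow> grid_cell n i j \<in> cells n"
  unfolding cells_eq_grid by auto

lemma prod_cells_grid:
  fixes f :: "sq \<Rightarrow> real"
  shows "(\<Prod>s\<in>cells n. f s) = (\<Prod>i\<le>n. \<Prod>j\<le>n. f (grid_cell n i j))"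
proof -
  have "inj_on (\<lambda>(i, j). grid_cell n i j) ({..n} \<times> {..n})"
    by (auto simp: inj_on_def grid_cell_def)
  then have "(\<Prod>s\<in>cells n. f s) = (\<Prod>p\<in>{..n} \<times> {..n}. f (case p of (i, j) \<Rightarrow> grid_cell n i j))"
    unfolding cells_eq_grid by (simp add: prod.reindex)
  then show ?thesis by (simp add: prod.cartesian_product split_def)
qed

lemma cell_index_grid: "cell_index n (grid_cell n i j) = Suc i"
proof -
  have "diag (Suc n) (grid_cell n i j) + 1 = 2 * (int i + 1)"
    by (simp add: diag_def grid_cell_def)
  then show ?thesis unfolding cell_index_def by (simp add: nat_add_distrib)
qed

lemma ur_covered_iff_next:
  assumes T: "T \<in> tilings (Suc n)" and s: "(x, y) \<in> cells n"
  shows "ur_covered T (x, y) \<longleftrightarrow> \<not> ll_covered T (x + 1, y + 1)"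
proof -
  have "even (y + 1 - (x + 1) + int n)" using s by (simp add: mem_cells)
  then have "(x + 1, y + 1) \<in> aztec (Suc n)" using s by (simp add: aztec_even)
  then have "exactly_one4 (Hor (x + 1, y + 1) \<in> T) (Hor (x + 1 - 1, y + 1) \<in> T)
      (Ver (x + 1, y + 1) \<in> T) (Ver (x + 1, y + 1 - 1) \<in> T)"
    using T unfolding mem_tilings by presburger
  then show ?thesis unfolding ur_covered_def ll_covered_def exactly_one4_def by auto
qed

lemma ll_covered_first:
  assumes T: "T \<in> tilings (Suc n)" and s: "(x, y) \<in> cells n" "(x - 1, y - 1) \<notin> cells n"
  shows "ll_covered T (x, y)"
proof -
  have ev: "even (y - x + int n)" "even (y - 1 - (x - 1) + int n)" using s by (simp_all add: mem_cells)
  then have "(x, y) \<in> aztec (Suc n)" using s by (simp add: aztec_even)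
  then have one: "exactly_one4 (Hor (x, y) \<in> T) (Hor (x - 1, y) \<in> T) (Ver (x, y) \<in> T) (Ver (x, y - 1) \<in> T)"
    using T unfolding mem_tilings by presburger
  have "T \<subseteq> cell_dominoes n" using T tiling_subset_cell_dominoes by blast
  from outside_cells[OF this ev(2) s(2)] one show ?thesis
    unfolding ll_covered_def exactly_one4_def by auto
qed

lemma ur_covered_last:
  assumes T: "T \<in> tilings (Suc n)" and s: "(x, y) \<in> cells n" "(x + 1, y + 1) \<notin> cells n"
  shows "ur_covered T (x, y)"
proof -
  have ev: "even (y + 1 - (x + 1) + int n)" using s by (simp add: mem_cells)
  have "T \<subseteq> cell_dominoes n" using T tiling_subset_cell_dominoes by blast
  from outside_cells[OF this ev s(2)] show ?thesis
    unfolding ur_covered_iff_next[OF T s(1)] ll_covered_def by blast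
qed

lemma empties_fulls_covered:
  assumes T: "T \<in> tilings r" and s: "s \<in> cells n"
  shows "s \<in> empties n T \<longleftrightarrow> \<not> ll_covered T s \<and> \<not> ur_covered T s"
    and "s \<in> fulls n T \<longleftrightarrow> ll_covered T s \<and> ur_covered T s"
proof -
  obtain x y where xy: "s = (x, y)" by (cases s)
  show "s \<in> empties n T \<longleftrightarrow> \<not> ll_covered T s \<and> \<not> ur_covered T s"
    using s by (auto simp: empties_def ll_covered_def ur_covered_def)
  show "s \<in> fulls n T \<longleftrightarrow> ll_covered T s \<and> ur_covered T s"
    using s tiling_cell_disjoint[OF T, of x y] unfolding xy fulls_def ll_covered_def ur_covered_def by auto
qed

text \<open>
  Since consecutive cells share a square, a color covers the upper-right square of a cell from inside iff
  it does not cover the lower-left square of the next cell from inside.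
\<close>

lemma diagonal_exchange:
  fixes F :: "nat \<Rightarrow> real"
  assumes T: "\<And>a. a \<in> {1..k} \<Longrightarrow> T a \<in> tilings (Suc n)" and i: "i \<le> n"
  shows "(\<Prod>j\<le>n. \<Prod>a\<in>{a \<in> {1..k}. grid_cell n i j \<in> fulls n (T a)}. F (interaction_exponent k T a (grid_cell n i j))) =
    (\<Prod>j\<le>n. \<Prod>a\<in>{a \<in> {1..k}. grid_cell n i j \<in> empties n (T a)}. F (interaction_exponent k T a (grid_cell n i j))) *
    prod F {..<k}"
proof -
  define S where "S j = {a \<in> {1..k}. j \<le> n \<and> ll_covered (T a) (grid_cell n i j)}" for j
  define e where "e j a = card {m \<in> {1..k}. m < a \<and> m \<in> S (Suc j)} + card {m \<in> {1..k}. a < m \<and> m \<in> S j}" for j a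
  \<comment> \<open>The ends of the diagonal lie in one cell only, which fixes the first and the last set.\<close>
  have S0: "S 0 = {1..k}"
  proof -
    have "ll_covered (T a) (grid_cell n i 0)" if "a \<in> {1..k}" for a
      unfolding grid_cell_def
      by (rule ll_covered_first[OF T[OF that]]) (use i in \<open>auto simp: mem_cells\<close>)
    then show ?thesis by (auto simp: S_def)
  qed
  have Sn: "S (Suc n) = {}" by (simp add: S_def)
  have ur: "\<not> ur_covered (T a) (grid_cell n i j) \<longleftrightarrow> a \<in> S (Suc j)" if a: "a \<in> {1..k}" and j: "j \<le> n" for a j
  proof (cases "j = n")
    case True
    have "ur_covered (T a) (grid_cell n i j)"
      unfolding grid_cell_def
      by (rule ur_covered_last[OF T[OF a]]) (use i True in \<open>auto simp: mem_cells\<close>)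
    then show ?thesis using True by (simp add: S_def)
  next
    case False
    have "(int j - int i - 1, int i + int j - int n - 1) \<in> cells n"
      using grid_cell_mem[OF i j] by (simp add: grid_cell_def)
    from ur_covered_iff_next[OF T[OF a] this]
    have "ur_covered (T a) (grid_cell n i j) \<longleftrightarrow> \<not> ll_covered (T a) (grid_cell n i (Suc j))"
      by (simp add: grid_cell_def algebra_simps)
    then show ?thesis using False a j by (simp add: S_def)
  qed
  have ll: "ll_covered (T a) (grid_cell n i j) \<longleftrightarrow> a \<in> S j" if "a \<in> {1..k}" "j \<le> n" for a j
    using that by (simp add: S_def)
  have interaction_exponent: "interaction_exponent k T a (grid_cell n i j) = e j a" if j: "j \<le> n" for a j
  proof -
    have "{m \<in> {1..k}. m < a \<and> \<not> ur_covered (T m) (grid_cell n i j)} = {m \<in> {1..k}. m < a \<and> m \<in> S (Suc j)}"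
      "{m \<in> {1..k}. a < m \<and> ll_covered (T m) (grid_cell n i j)} = {m \<in> {1..k}. a < m \<and> m \<in> S j}"
      using ur ll j by blast+
    then show ?thesis by (simp add: interaction_exponent_def e_def)
  qed
  have fulls: "{a \<in> {1..k}. grid_cell n i j \<in> fulls n (T a)} = S j - S (Suc j)"
    and empties: "{a \<in> {1..k}. grid_cell n i j \<in> empties n (T a)} = S (Suc j) - S j" if j: "j \<le> n" for j
  proof -
    have "a \<in> {1..k} \<Longrightarrow> grid_cell n i j \<in> fulls n (T a) \<longleftrightarrow> a \<in> S j \<and> a \<notin> S (Suc j)"
      "a \<in> {1..k} \<Longrightarrow> grid_cell n i j \<in> empties n (T a) \<longleftrightarrow> a \<in> S (Suc j) \<and> a \<notin> S j" for a
      using empties_fulls_covered[OF T grid_cell_mem[OF i j]] ur[OF _ j] ll[OF _ j] by blast+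
    moreover have "S j \<subseteq> {1..k}" "S (Suc j) \<subseteq> {1..k}" by (auto simp: S_def)
    ultimately show "{a \<in> {1..k}. grid_cell n i j \<in> fulls n (T a)} = S j - S (Suc j)"
      "{a \<in> {1..k}. grid_cell n i j \<in> empties n (T a)} = S (Suc j) - S j" by blast+
  qed
  have "(\<Prod>j<Suc n. \<Prod>a\<in>S j - S (Suc j). F (e j a)) * prod F {..<card (S (Suc n))} =
    (\<Prod>j<Suc n. \<Prod>a\<in>S (Suc j) - S j. F (e j a)) * prod F {..<card (S 0)}"
    unfolding e_def by (rule chain_telescope) (auto simp: S_def)
  then have *: "(\<Prod>j\<le>n. \<Prod>a\<in>S j - S (Suc j). F (e j a)) =
      (\<Prod>j\<le>n. \<Prod>a\<in>S (Suc j) - S j. F (e j a)) * prod F {..<k}"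
    unfolding S0 Sn lessThan_Suc_atMost by simp
  have "(\<Prod>j\<le>n. \<Prod>a\<in>{a \<in> {1..k}. grid_cell n i j \<in> fulls n (T a)}. F (interaction_exponent k T a (grid_cell n i j))) =
      (\<Prod>j\<le>n. \<Prod>a\<in>S j - S (Suc j). F (e j a))"
    by (rule prod.cong[OF refl]) (simp only: fulls interaction_exponent atMost_iff)
  moreover have "(\<Prod>j\<le>n. \<Prod>a\<in>{a \<in> {1..k}. grid_cell n i j \<in> empties n (T a)}. F (interaction_exponent k T a (grid_cell n i j))) =
      (\<Prod>j\<le>n. \<Prod>a\<in>S (Suc j) - S j. F (e j a))"
    by (rule prod.cong[OF refl]) (simp only: empties interaction_exponent atMost_iff)
  ultimately show ?thesis using * by simp
qed

lemma fulls_empties_exchange: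
  assumes T: "T \<in> ktilings k (Suc n)"
  shows "(\<Prod>a\<in>{1..k}. \<Prod>s\<in>fulls n (T a). 1 + cell_weight b c n s * t ^ interaction_exponent k T a s) =
    (\<Prod>a\<in>{1..k}. \<Prod>s\<in>empties n (T a). 1 + cell_weight b c n s * t ^ interaction_exponent k T a s) *
    (\<Prod>i\<le>n. \<Prod>l<k. 1 + c (Suc i) * b (Suc n - i) * t ^ l)"
proof -
  let ?F = "\<lambda>i l. 1 + c (Suc i) * b (Suc n - i) * t ^ l"
  have regroup: "(\<Prod>a\<in>{1..k}. \<Prod>s\<in>{s \<in> cells n. s \<in> E a}. 1 + cell_weight b c n s * t ^ interaction_exponent k T a s) =
     (\<Prod>i\<le>n. \<Prod>j\<le>n. \<Prod>a\<in>{a \<in> {1..k}. grid_cell n i j \<in> E a}. ?F i (interaction_exponent k T a (grid_cell n i j)))" for E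
  proof -
    have "(\<Prod>a\<in>{1..k}. \<Prod>s\<in>{s \<in> cells n. s \<in> E a}. 1 + cell_weight b c n s * t ^ interaction_exponent k T a s) =
       (\<Prod>s\<in>cells n. \<Prod>a\<in>{a \<in> {1..k}. s \<in> E a}. 1 + cell_weight b c n s * t ^ interaction_exponent k T a s)"
      by (rule prod.swap_restrict) (auto simp: finite_cells)
    also have "\<dots> = (\<Prod>i\<le>n. \<Prod>j\<le>n. \<Prod>a\<in>{a \<in> {1..k}. grid_cell n i j \<in> E a}. ?F i (interaction_exponent k T a (grid_cell n i j)))"
      unfolding prod_cells_grid by (intro prod.cong refl) (simp add: cell_weight_def cell_index_grid Suc_diff_le)
    finally show ?thesis .
  qed
  have mem: "T a \<in> tilings (Suc n)" if "a \<in> {1..k}" for a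
    using T that unfolding ktilings_def by (auto simp: PiE_iff)
  have E: "{s \<in> cells n. s \<in> fulls n X} = fulls n X" "{s \<in> cells n. s \<in> empties n X} = empties n X" for X
    by (auto simp: fulls_def empties_def)
  have "(\<Prod>i\<le>n. \<Prod>j\<le>n. \<Prod>a\<in>{a \<in> {1..k}. grid_cell n i j \<in> fulls n (T a)}. ?F i (interaction_exponent k T a (grid_cell n i j))) =
     (\<Prod>i\<le>n. (\<Prod>j\<le>n. \<Prod>a\<in>{a \<in> {1..k}. grid_cell n i j \<in> empties n (T a)}. ?F i (interaction_exponent k T a (grid_cell n i j))) *
       prod (?F i) {..<k})"
    by (intro prod.cong refl diagonal_exchange) (use mem in auto)
  then show ?thesis
    using regroup[of "\<lambda>a. fulls n (T a)"] regroup[of "\<lambda>a. empties n (T a)"] unfolding E prod.distrib by simp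
qed

section \<open>The law of one step\<close>

text \<open>
  The odds for a horizontal pair, expressed through the \<open>k\<close>-tiling \<open>D\<close> before the step.
\<close>

definition horizontal_odds ::
  "(nat \<Rightarrow> real) \<Rightarrow> (nat \<Rightarrow> real) \<Rightarrow> real \<Rightarrow> nat \<Rightarrow> nat \<Rightarrow> (nat \<Rightarrow> domino set) \<Rightarrow> nat \<Rightarrow> sq \<Rightarrow> real" where
  "horizontal_odds b c t k n D a s = cell_weight b c n s *
     t ^ (card {m \<in> {1..k}. m < a \<and> ur_covered (D m) s} + card {m \<in> {1..k}. a < m \<and> \<not> ll_covered (D m) s})"

definition refill_pmf :: "(sq \<Rightarrow> real) \<Rightarrow> nat \<Rightarrow> domino set \<Rightarrow> domino set pmf" where
  "refill_pmf p n X = map_pmf (refill n X) (Pi_pmf (empties n X) False (\<lambda>s. bernoulli_pmf (p s)))"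

lemma spider_covered:
  assumes "spider n D D'" "s \<in> cells n"
  shows "ur_covered D' s \<longleftrightarrow> \<not> ur_covered D s" "ll_covered D' s \<longleftrightarrow> \<not> ll_covered D s"
  using assms spider_complement[of n D D'] by (cases s; simp add: ur_covered_def ll_covered_def)+

text \<open>
  Colors above \<open>l\<close> carry their slid dominoes only.  The lower-left square is then occupied in one of
  the prescribed ways iff the cell is empty or its only domino has just slid onto that
  square, that is, iff the square was not covered from inside before.
\<close>

lemma num1_partial:
  assumes D: "\<And>m. m \<in> {1..k} \<Longrightarrow> D m \<in> tilings n"
    and C: "\<And>m. m \<in> {1..k} \<Longrightarrow> l < m \<Longrightarrow> C m = slide_destroy n (D m)"
    and s: "s \<in> cells n"
  shows "num1 k (Suc n) C l s = card {m \<in> {1..k}. l < m \<and> \<not> ll_covered (D m) s}"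
proof -
  have "s \<in> creation_blocks (Suc n) (C m) \<or> Ver s \<in> C m \<or> Hor s \<in> C m \<longleftrightarrow> \<not> ll_covered (D m) s"
    if m: "m \<in> {1..k}" "l < m" for m
  proof -
    obtain x y where xy: "s = (x, y)" by (cases s)
    have "Hor s \<in> C m \<longleftrightarrow> Hor (nbr North s) \<in> D m \<and> Hor s \<notin> D m"
      "Ver s \<in> C m \<longleftrightarrow> Ver (nbr East s) \<in> D m \<and> Ver s \<notin> D m"
      using state_slide_destroy[OF s, of "D m"] C[OF m] by (simp_all add: state_def)
    moreover have "creation_blocks (Suc n) (C m) = empties n (D m)"
      using creation_blocks_slide_destroy[OF D[OF m(1)]] C[OF m] by simp
    ultimately show ?thesis
      using s tiling_cell_disjoint[OF D[OF m(1)], of x y] unfolding xy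
      by (auto simp: empties_def ll_covered_def)
  qed
  then show ?thesis unfolding num1_def by (intro arg_cong[where f = card]) blast
qed

text \<open>
  Colors below \<open>l\<close> are already complete, and their upper-right square is covered from the next cell iff it is not
  covered from inside, which by complementation means that it was before the step.
\<close>

lemma num2_filled:
  assumes C: "\<And>m. m \<in> {1..k} \<Longrightarrow> m < l \<Longrightarrow> C m \<in> tilings (Suc n) \<and> spider n (D m) (C m)"
    and s: "s \<in> cells n"
  shows "num2 k C l s = card {m \<in> {1..k}. m < l \<and> ur_covered (D m) s}"
proof -
  have "Hor (nbr North (nbr East s)) \<in> C m \<or> Ver (nbr North (nbr East s)) \<in> C m \<longleftrightarrow> ur_covered (D m) s"
    if m: "m \<in> {1..k}" "m < l" for m
  proof -
    obtain x y where xy: "s = (x, y)" by (cases s)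
    have "ur_covered (C m) s \<longleftrightarrow> \<not> ll_covered (C m) (x + 1, y + 1)"
      using ur_covered_iff_next[of "C m" n x y] C[OF m] s unfolding xy by blast
    moreover have "ur_covered (C m) s \<longleftrightarrow> \<not> ur_covered (D m) s"
      using spider_covered(1)[OF conjunct2[OF C[OF m]] s] .
    ultimately show ?thesis by (simp add: xy ll_covered_def) blast
  qed
  then show ?thesis unfolding num2_def by (intro arg_cong[where f = card]) blast
qed

text \<open>
  The probabilities used by the algorithm do not depend on the random choices made for smaller
  colors.
\<close>

lemma hor_prob_partial:
  assumes D: "\<And>m. m \<in> {1..k} \<Longrightarrow> D m \<in> tilings n"
    and C: "\<And>m. m \<in> {1..k} \<Longrightarrow> l < m \<Longrightarrow> C m = slide_destroy n (D m)"
    and C': "\<And>m. m \<in> {1..k} \<Longrightarrow> m < l \<Longrightarrow> C m \<in> tilings (Suc n) \<and> spider n (D m) (C m)"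
    and s: "s \<in> cells n"
  shows "hor_prob b c t k (Suc n) C l s =
    horizontal_odds b c t k n D l s / (1 + horizontal_odds b c t k n D l s)"
proof -
  have "num1 k (Suc n) C l s + num2 k C l s =
     card {m \<in> {1..k}. m < l \<and> ur_covered (D m) s} + card {m \<in> {1..k}. l < m \<and> \<not> ll_covered (D m) s}"
    using num1_partial[of k D n l C s] num2_filled[of k l C n D s] assms by simp
  then show ?thesis
    unfolding hor_prob_def Let_def horizontal_odds_def cell_weight_def cell_index_def by simp
qed

lemma fill_color_partial:
  assumes D: "\<And>m. m \<in> {1..k} \<Longrightarrow> D m \<in> tilings n"
    and l: "l \<in> {1..k}"
    and C: "\<And>m. m \<in> {1..k} \<Longrightarrow> l \<le> m \<Longrightarrow> C m = slide_destroy n (D m)"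
    and C': "\<And>m. m \<in> {1..k} \<Longrightarrow> m < l \<Longrightarrow> C m \<in> tilings (Suc n) \<and> spider n (D m) (C m)"
  shows "fill_color b c t k (Suc n) l C = map_pmf (\<lambda>X. C(l := X))
    (refill_pmf (\<lambda>s. horizontal_odds b c t k n D l s / (1 + horizontal_odds b c t k n D l s)) n (D l))"
proof -
  have cb: "creation_blocks (Suc n) (C l) = empties n (D l)"
    using creation_blocks_slide_destroy[OF D[OF l]] C[OF l] by simp
  have Pi: "Pi_pmf (empties n (D l)) False (\<lambda>s. bernoulli_pmf (hor_prob b c t k (Suc n) C l s)) =
     Pi_pmf (empties n (D l)) False (\<lambda>s. bernoulli_pmf (horizontal_odds b c t k n D l s / (1 + horizontal_odds b c t k n D l s)))"
  proof (rule Pi_pmf_cong[OF refl refl])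
    fix s assume "s \<in> empties n (D l)"
    then have "s \<in> cells n" using empties_subset by blast
    then have "hor_prob b c t k (Suc n) C l s = horizontal_odds b c t k n D l s / (1 + horizontal_odds b c t k n D l s)"
      using hor_prob_partial[of k D n l C s] D C C' by auto
    then show "bernoulli_pmf (hor_prob b c t k (Suc n) C l s) =
      bernoulli_pmf (horizontal_odds b c t k n D l s / (1 + horizontal_odds b c t k n D l s))" by simp
  qed
  show ?thesis
    unfolding fill_color_def Let_def cb Pi refill_pmf_def pmf.map_comp o_def refill_def
    using C[OF l] by simp
qed

lemma set_refill_pmf:
  assumes "X \<in> tilings n" "Y \<in> set_pmf (refill_pmf p n X)"
  shows "Y \<in> tilings (Suc n) \<and> spider n X Y"
  using assms spider_refill[of X n] spider_tilings_iff unfolding refill_pmf_def by fastforce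

text \<open>
  By the independence of the probabilities from earlier choices, the colors are filled
  independently.
\<close>

lemma fill_colors_eq:
  fixes b c :: "nat \<Rightarrow> real" and t :: real
  assumes D: "\<And>m. m \<in> {1..k} \<Longrightarrow> D m \<in> tilings n" and "l \<le> k"
  defines "q \<equiv> \<lambda>a. refill_pmf (\<lambda>s. horizontal_odds b c t k n D a s / (1 + horizontal_odds b c t k n D a s)) n (D a)"
  shows "fill_colors b c t k (Suc n) l (\<lambda>a\<in>{1..k}. slide_destroy n (D a)) =
    map_pmf (\<lambda>F. \<lambda>a\<in>{1..k}. if a \<le> l then F a else slide_destroy n (D a)) (Pi_pmf {1..l} undefined q)"
  using \<open>l \<le> k\<close>
proof (induction l)
  case 0
  have "(\<lambda>a\<in>{1..k}. if a \<le> 0 then undefined else slide_destroy n (D a)) = (\<lambda>a\<in>{1..k}. slide_destroy n (D a))"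
    by (rule restrict_ext) simp
  moreover have "Pi_pmf {1..0} undefined q = return_pmf (\<lambda>_. undefined)" by simp
  ultimately show ?case by (simp only: fill_colors.simps map_return_pmf)
next
  case (Suc l)
  let ?G = "\<lambda>l F. \<lambda>a\<in>{1..k}. if a \<le> l then F a else slide_destroy n (D a)"
  have "fill_colors b c t k (Suc n) (Suc l) (\<lambda>a\<in>{1..k}. slide_destroy n (D a)) =
      bind_pmf (Pi_pmf {1..l} undefined q) (\<lambda>F. fill_color b c t k (Suc n) (Suc l) (?G l F))"
    by (simp only: fill_colors.simps Suc.IH[OF Suc_leD[OF Suc.prems]] bind_map_pmf)
  also have "\<dots> = bind_pmf (Pi_pmf {1..l} undefined q) (\<lambda>F. map_pmf (\<lambda>X. (?G l F)(Suc l := X)) (q (Suc l)))"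
  proof (rule bind_pmf_cong[OF refl])
    fix F assume "F \<in> set_pmf (Pi_pmf {1..l} undefined q)"
    then have F: "F m \<in> set_pmf (q m)" if "m \<in> {1..l}" for m
      using that by (auto simp: set_Pi_pmf PiE_dflt_def)
    show "fill_color b c t k (Suc n) (Suc l) (?G l F) = map_pmf (\<lambda>X. (?G l F)(Suc l := X)) (q (Suc l))"
      unfolding q_def
    proof (rule fill_color_partial[OF D])
      fix m assume m: "m \<in> {1..k}" "m < Suc l"
      then show "?G l F m \<in> tilings (Suc n) \<and> spider n (D m) (?G l F m)"
        using set_refill_pmf[OF D[OF m(1)]] F[of m] by (auto simp: q_def)
    qed (use Suc.prems in auto)
  qed
  also have "\<dots> = bind_pmf (Pi_pmf {1..l} undefined q) (\<lambda>F. map_pmf (\<lambda>X. ?G (Suc l) (F(Suc l := X))) (q (Suc l)))"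
  proof -
    have "(?G l F)(Suc l := X) = ?G (Suc l) (F(Suc l := X))" for F X
      using Suc.prems by (auto simp: restrict_def fun_eq_iff)
    then show ?thesis by simp
  qed
  also have "\<dots> = bind_pmf (q (Suc l)) (\<lambda>X. bind_pmf (Pi_pmf {1..l} undefined q) (\<lambda>F. return_pmf (?G (Suc l) (F(Suc l := X)))))"
    unfolding map_pmf_def by (rule bind_commute_pmf)
  also have "\<dots> = map_pmf (?G (Suc l)) (Pi_pmf (insert (Suc l) {1..l}) undefined q)"
    by (subst Pi_pmf_insert') (simp_all add: map_bind_pmf)
  also have "insert (Suc l) {1..l} = {1..Suc l}" by auto
  finally show ?case .
qed

lemma fill_colors_all:
  assumes D: "\<And>m. m \<in> {1..k} \<Longrightarrow> D m \<in> tilings n"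
  shows "fill_colors b c t k (Suc n) k (\<lambda>a\<in>{1..k}. slide_destroy n (D a)) = Pi_pmf {1..k} undefined
    (\<lambda>a. refill_pmf (\<lambda>s. horizontal_odds b c t k n D a s / (1 + horizontal_odds b c t k n D a s)) n (D a))"
proof -
  let ?q = "\<lambda>a. refill_pmf (\<lambda>s. horizontal_odds b c t k n D a s / (1 + horizontal_odds b c t k n D a s)) n (D a)"
  have "fill_colors b c t k (Suc n) k (\<lambda>a\<in>{1..k}. slide_destroy n (D a)) =
     map_pmf (\<lambda>F. \<lambda>a\<in>{1..k}. if a \<le> k then F a else slide_destroy n (D a)) (Pi_pmf {1..k} undefined ?q)"
    by (rule fill_colors_eq) (use D in auto)
  also have "\<dots> = map_pmf id (Pi_pmf {1..k} undefined ?q)"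
  proof (rule map_pmf_cong[OF refl])
    fix F assume "F \<in> set_pmf (Pi_pmf {1..k} undefined ?q)"
    then have "F a = undefined" if "a \<notin> {1..k}" for a
      using that set_Pi_pmf_subset[of "{1..k}" undefined ?q] by auto
    then show "(\<lambda>a\<in>{1..k}. if a \<le> k then F a else slide_destroy n (D a)) = id F"
      by (auto simp: restrict_def fun_eq_iff)
  qed
  finally show ?thesis by simp
qed

lemma pmf_refill_pmf:
  assumes p: "\<And>s. s \<in> empties n X \<Longrightarrow> 0 \<le> p s \<and> p s \<le> 1" and X: "X \<in> tilings n"
  shows "pmf (refill_pmf p n X) Y =
    (if spider n X Y then \<Prod>s\<in>empties n X. if Hor s \<in> Y then p s else 1 - p s else 0)"
proof (cases "spider n X Y")
  case False
  then have "Y \<notin> set_pmf (refill_pmf p n X)" using set_refill_pmf[OF X] by blast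
  then show ?thesis using False by (simp add: set_pmf_iff)
next
  case True
  let ?M = "Pi_pmf (empties n X) False (\<lambda>s. bernoulli_pmf (p s))"
  \<comment> \<open>Among the fillings with the default value \<open>False\<close> outside the empty cells, only \<open>h\<close> leads to \<open>Y\<close>.\<close>
  define h where "h s \<longleftrightarrow> s \<in> empties n X \<and> Hor s \<in> Y" for s
  have Y: "refill n X h = Y"
    using spider_imp_refill[OF True] refill_cong[of n X h "\<lambda>s. Hor s \<in> Y"] by (simp add: h_def)
  have "pmf (refill_pmf p n X) Y = measure ?M (refill n X -` {Y})"
    unfolding refill_pmf_def pmf_map ..
  also have "\<dots> = measure ?M {h}"
  proof (rule measure_prob_cong_0)
    fix g assume g: "g \<in> refill n X -` {Y} - {h}"
    then have "refill n X g = Y" "g \<noteq> h" by auto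
    then have "g s \<longleftrightarrow> h s" if "s \<in> empties n X" for s
      using Hor_mem_refill[OF that, of g] that by (simp add: h_def)
    with \<open>g \<noteq> h\<close> have "\<exists>s. s \<notin> empties n X \<and> g s \<noteq> False"
      by (auto simp: h_def fun_eq_iff)
    then show "pmf ?M g = 0" by (rule pmf_Pi_outside[OF finite_empties])
  next
    fix g assume "g \<in> {h} - refill n X -` {Y}"
    then show "pmf ?M g = 0" using Y by auto
  qed
  also have "\<dots> = (\<Prod>s\<in>empties n X. pmf (bernoulli_pmf (p s)) (h s))"
    unfolding measure_pmf_single by (rule pmf_Pi'[OF finite_empties]) (simp add: h_def)
  also have "\<dots> = (\<Prod>s\<in>empties n X. if Hor s \<in> Y then p s else 1 - p s)"
    using p by (intro prod.cong refl) (simp add: h_def pmf_bernoulli_True pmf_bernoulli_False)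
  finally show ?thesis using True by simp
qed

lemma cell_weight_pos:
  assumes "\<And>i. i \<in> {1..Suc n} \<Longrightarrow> c i > 0" "\<And>i. i \<in> {1..Suc n} \<Longrightarrow> b i > 0" "s \<in> cells n"
  shows "cell_weight b c n s > 0"
proof -
  have "cell_index n s \<in> {1..Suc n}" by (rule cell_index_range[OF assms(3)])
  then show ?thesis unfolding cell_weight_def by (intro mult_pos_pos assms) auto
qed

text \<open>
  In a possible transition the coverage before and after the step are complementary, so the odds
  may be written in terms of the target \<open>D'\<close>.
\<close>

lemma pmf_step:
  assumes c: "\<And>i. i \<in> {1..Suc n} \<Longrightarrow> c i > 0" and b: "\<And>i. i \<in> {1..Suc n} \<Longrightarrow> b i > 0" and t: "t \<ge> 0"
    and D: "D \<in> ktilings k n" and D': "D' \<in> ktilings k (Suc n)"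
  defines "y \<equiv> \<lambda>a s. cell_weight b c n s * t ^ interaction_exponent k D' a s"
  shows "pmf (fill_colors b c t k (Suc n) k (\<lambda>a\<in>{1..k}. slide_destroy n (D a))) D' =
    (if \<forall>a\<in>{1..k}. spider n (D a) (D' a)
     then (\<Prod>a\<in>{1..k}. \<Prod>s\<in>empties n (D a). if Hor s \<in> D' a then y a s else 1) /
       (\<Prod>a\<in>{1..k}. \<Prod>s\<in>empties n (D a). 1 + y a s)
     else 0)"
proof -
  let ?o = "horizontal_odds b c t k n D"
  have mem: "D a \<in> tilings n" if "a \<in> {1..k}" for a
    using D that unfolding ktilings_def by (auto simp: PiE_iff)
  have ext: "D' a = undefined" if "a \<notin> {1..k}" for a
    using D' that unfolding ktilings_def by (rule PiE_arb)
  have pos: "?o a s \<ge> 0" if s: "s \<in> empties n (D a)" for a s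
  proof -
    have "s \<in> cells n" using s empties_subset by blast
    have "cell_weight b c n s > 0" by (rule cell_weight_pos; fact)
    then show ?thesis unfolding horizontal_odds_def using t by simp
  qed
  have prob: "0 \<le> ?o a s / (1 + ?o a s) \<and> ?o a s / (1 + ?o a s) \<le> 1" if "s \<in> empties n (D a)" for a s
    using pos[OF that] by (simp add: divide_le_eq)
  have K: "fill_colors b c t k (Suc n) k (\<lambda>a\<in>{1..k}. slide_destroy n (D a)) = Pi_pmf {1..k} undefined
    (\<lambda>a. refill_pmf (\<lambda>s. ?o a s / (1 + ?o a s)) n (D a))"
    by (rule fill_colors_all) (fact mem)
  have "pmf (fill_colors b c t k (Suc n) k (\<lambda>a\<in>{1..k}. slide_destroy n (D a))) D' =
     (\<Prod>a\<in>{1..k}. pmf (refill_pmf (\<lambda>s. ?o a s / (1 + ?o a s)) n (D a)) (D' a))"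
    unfolding K by (rule pmf_Pi') (use ext in auto)
  also have "\<dots> = (\<Prod>a\<in>{1..k}. if spider n (D a) (D' a) then
       \<Prod>s\<in>empties n (D a). if Hor s \<in> D' a then ?o a s / (1 + ?o a s) else 1 - ?o a s / (1 + ?o a s) else 0)"
    by (intro prod.cong refl pmf_refill_pmf mem prob)
  finally have eq: "pmf (fill_colors b c t k (Suc n) k (\<lambda>a\<in>{1..k}. slide_destroy n (D a))) D' = \<dots>" .
  show ?thesis
  proof (cases "\<forall>a\<in>{1..k}. spider n (D a) (D' a)")
    case False
    then show ?thesis unfolding eq by (auto intro: prod_zero)
  next
    case True
    have oy: "?o a s = y a s" if "s \<in> cells n" for a s
    proof -
      have "{m \<in> {1..k}. m < a \<and> ur_covered (D m) s} = {m \<in> {1..k}. m < a \<and> \<not> ur_covered (D' m) s}"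
        "{m \<in> {1..k}. a < m \<and> \<not> ll_covered (D m) s} = {m \<in> {1..k}. a < m \<and> ll_covered (D' m) s}"
        using spider_covered[OF bspec[OF True] that] by blast+
      then show ?thesis by (simp add: horizontal_odds_def y_def interaction_exponent_def)
    qed
    have "(\<Prod>s\<in>empties n (D a). if Hor s \<in> D' a then ?o a s / (1 + ?o a s) else 1 - ?o a s / (1 + ?o a s)) =
       (\<Prod>s\<in>empties n (D a). if Hor s \<in> D' a then y a s else 1) / (\<Prod>s\<in>empties n (D a). 1 + y a s)" for a
      unfolding prod_dividef[symmetric]
    proof (rule prod.cong[OF refl])
      fix s assume s: "s \<in> empties n (D a)"
      then have "?o a s = y a s" using oy empties_subset by blast
      moreover have "1 + y a s \<noteq> 0" using pos[OF s] calculation by simp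
      ultimately show "(if Hor s \<in> D' a then ?o a s / (1 + ?o a s) else 1 - ?o a s / (1 + ?o a s)) =
        (if Hor s \<in> D' a then y a s else 1) / (1 + y a s)"
        by (simp add: divide_simps)
    qed
    then show ?thesis unfolding eq using True by (simp add: prod_dividef)
  qed
qed

lemma set_fill_colors:
  assumes D: "D \<in> ktilings k n"
  shows "set_pmf (fill_colors b c t k (Suc n) k (\<lambda>a\<in>{1..k}. slide_destroy n (D a))) \<subseteq> ktilings k (Suc n)"
proof -
  have mem: "D a \<in> tilings n" if "a \<in> {1..k}" for a
    using D that unfolding ktilings_def by (auto simp: PiE_iff)
  have K: "fill_colors b c t k (Suc n) k (\<lambda>a\<in>{1..k}. slide_destroy n (D a)) = Pi_pmf {1..k} undefined
    (\<lambda>a. refill_pmf (\<lambda>s. horizontal_odds b c t k n D a s / (1 + horizontal_odds b c t k n D a s)) n (D a))"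
    by (rule fill_colors_all) (fact mem)
  show ?thesis
    unfolding K ktilings_def
    using set_refill_pmf[OF mem] by (fastforce simp: set_Pi_pmf PiE_dflt_def PiE_iff extensional_def)
qed

section \<open>The output distribution\<close>

text \<open>
  The partition function of rank \<open>n + 1\<close> divided by that of rank \<open>n\<close>.
\<close>

definition partition_ratio :: "(nat \<Rightarrow> real) \<Rightarrow> (nat \<Rightarrow> real) \<Rightarrow> real \<Rightarrow> nat \<Rightarrow> nat \<Rightarrow> real" where
  "partition_ratio b c t k n = (\<Prod>i\<le>n. \<Prod>l<k. 1 + c (Suc i) * b (Suc n - i) * t ^ l)"

lemma partition_ratio_pos:
  assumes c: "\<And>i. i \<in> {1..Suc n} \<Longrightarrow> c i > 0" and b: "\<And>i. i \<in> {1..Suc n} \<Longrightarrow> b i > 0" and t: "t \<ge> 0"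
  shows "partition_ratio b c t k n > 0"
  unfolding partition_ratio_def
proof (intro prod_pos ballI)
  fix i l assume "i \<in> {..n}"
  then have "c (Suc i) > 0" "b (Suc n - i) > 0" using c[of "Suc i"] b[of "Suc n - i"] by auto
  then show "0 < 1 + c (Suc i) * b (Suc n - i) * t ^ l" using t by (intro add_pos_nonneg) auto
qed

text \<open>
  Detailed balance turns the sum over predecessors into the weight of \<open>D'\<close> times a quotient of products over
  its empty and full cells, and that quotient does not depend on \<open>D'\<close>.
\<close>

lemma weight_step:
  assumes c: "\<And>i. i \<in> {1..Suc n} \<Longrightarrow> c i > 0" and b: "\<And>i. i \<in> {1..Suc n} \<Longrightarrow> b i > 0" and t: "t \<ge> 0"
    and D': "D' \<in> ktilings k (Suc n)"
  shows "(\<Sum>D\<in>ktilings k n. ktiling_weight b c t k n D *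
      pmf (fill_colors b c t k (Suc n) k (\<lambda>a\<in>{1..k}. slide_destroy n (D a))) D') =
    ktiling_weight b c t k (Suc n) D' / partition_ratio b c t k n"
proof -
  define y where "y a s = cell_weight b c n s * t ^ interaction_exponent k D' a s" for a s
  let ?P = "{D \<in> ktilings k n. \<forall>a\<in>{1..k}. spider n (D a) (D' a)}"
  let ?W = "ktiling_weight b c t k (Suc n) D'"
  let ?F = "\<Prod>a\<in>{1..k}. \<Prod>s\<in>fulls n (D' a). 1 + y a s"
  let ?E = "\<Prod>a\<in>{1..k}. \<Prod>s\<in>empties n (D' a). 1 + y a s"
  have ypos: "1 + y a s > 0" if "s \<in> cells n" for a s
  proof -
    have "cell_weight b c n s > 0" by (rule cell_weight_pos; fact)
    then show ?thesis using t unfolding y_def by (intro add_pos_nonneg) auto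
  qed
  have Epos: "?E > 0"
    by (intro prod_pos ballI ypos subsetD[OF empties_subset])
  have step: "pmf (fill_colors b c t k (Suc n) k (\<lambda>a\<in>{1..k}. slide_destroy n (D a))) D' =
    (if \<forall>a\<in>{1..k}. spider n (D a) (D' a)
     then (\<Prod>a\<in>{1..k}. \<Prod>s\<in>empties n (D a). if Hor s \<in> D' a then y a s else 1) /
       (\<Prod>a\<in>{1..k}. \<Prod>s\<in>empties n (D a). 1 + y a s)
     else 0)" if "D \<in> ktilings k n" for D
    unfolding y_def by (rule pmf_step; fact)
  have "(\<Sum>D\<in>ktilings k n. ktiling_weight b c t k n D *
      pmf (fill_colors b c t k (Suc n) k (\<lambda>a\<in>{1..k}. slide_destroy n (D a))) D') =
    (\<Sum>D\<in>ktilings k n. if \<forall>a\<in>{1..k}. spider n (D a) (D' a) then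
       ktiling_weight b c t k n D * (\<Prod>a\<in>{1..k}. \<Prod>s\<in>empties n (D a). if Hor s \<in> D' a then y a s else 1) /
       (\<Prod>a\<in>{1..k}. \<Prod>s\<in>empties n (D a). 1 + y a s) else 0)"
    by (intro sum.cong refl) (simp only: step if_distrib[of "\<lambda>x. _ * x"] mult_zero_right times_divide_eq_right)
  also have "\<dots> = (\<Sum>D\<in>?P. ktiling_weight b c t k n D *
      (\<Prod>a\<in>{1..k}. \<Prod>s\<in>empties n (D a). if Hor s \<in> D' a then y a s else 1) /
       (\<Prod>a\<in>{1..k}. \<Prod>s\<in>empties n (D a). 1 + y a s))"
    by (rule sum.inter_filter[symmetric]) (rule finite_ktilings)
  also have "\<dots> = (\<Sum>D\<in>?P. ?W / ?F * (\<Prod>a\<in>{1..k}. \<Prod>s\<in>empties n (D' a). if Hor s \<in> D a then y a s else 1))"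
  proof (rule sum.cong[OF refl])
    fix D assume D: "D \<in> ?P"
    have "(\<Prod>a\<in>{1..k}. \<Prod>s\<in>empties n (D a). 1 + y a s) = ?F"
      using D spider_empties by (intro prod.cong) auto
    moreover have "ktiling_weight b c t k n D *
      (\<Prod>a\<in>{1..k}. \<Prod>s\<in>empties n (D a). if Hor s \<in> D' a then y a s else 1) =
      ?W * (\<Prod>a\<in>{1..k}. \<Prod>s\<in>empties n (D' a). if Hor s \<in> D a then y a s else 1)"
      unfolding y_def by (rule weight_exchange[OF _ D']) (use D in auto)
    ultimately show "ktiling_weight b c t k n D *
      (\<Prod>a\<in>{1..k}. \<Prod>s\<in>empties n (D a). if Hor s \<in> D' a then y a s else 1) /
       (\<Prod>a\<in>{1..k}. \<Prod>s\<in>empties n (D a). 1 + y a s) =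
      ?W / ?F * (\<Prod>a\<in>{1..k}. \<Prod>s\<in>empties n (D' a). if Hor s \<in> D a then y a s else 1)" by simp
  qed
  also have "\<dots> = ?W / ?F * ?E"
    unfolding sum_distrib_left[symmetric] sum_predecessor_ktilings[OF D'] ..
  also have "?F = ?E * partition_ratio b c t k n"
    unfolding y_def partition_ratio_def by (rule fulls_empties_exchange[OF D'])
  also have "?W / (?E * partition_ratio b c t k n) * ?E = ?W / partition_ratio b c t k n"
  proof -
    have "w / (e * p) * e = w / p" if "e > 0" for w e p :: real using that by simp
    from this[OF Epos] show ?thesis .
  qed
  finally show ?thesis .
qed

lemma kshuffle_distribution:
  assumes c: "\<And>i. i \<in> {1..N} \<Longrightarrow> c i > 0" and b: "\<And>i. i \<in> {1..N} \<Longrightarrow> b i > 0" and t: "t \<ge> 0"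
    and "n \<le> N"
  shows "set_pmf (kshuffle b c t k n) \<subseteq> ktilings k n \<and>
    (\<exists>Z>0. \<forall>T\<in>ktilings k n. pmf (kshuffle b c t k n) T = ktiling_weight b c t k n T / Z)"
  using \<open>n \<le> N\<close>
proof (induction n)
  case 0
  have az: "aztec 0 = {}" by (auto simp: mem_aztec) presburger
  have sq: "squares d \<noteq> {}" for d by (cases d) auto
  have til: "tilings 0 = {{}}" using sq unfolding tilings_def az covered_def by auto
  define T0 where "T0 = (\<lambda>a\<in>{1..k}. {} :: domino set)"
  have "ktilings k 0 = {T0}"
    unfolding ktilings_def til T0_def by (auto simp: PiE_iff extensional_def fun_eq_iff restrict_def)
  moreover have "interactions k 0 T0 = {}" by (simp add: interactions_def az)
  then have "ktiling_weight b c t k 0 T0 = 1"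
    by (simp add: ktiling_weight_def tiling_weight_def T0_def)
  moreover have "kshuffle b c t k 0 = return_pmf T0" by (simp only: kshuffle.simps T0_def)
  ultimately show ?case by (auto intro!: exI[of _ 1])
next
  case (Suc n)
  then obtain Z where supp: "set_pmf (kshuffle b c t k n) \<subseteq> ktilings k n" and Z: "Z > 0"
    and pmf: "\<And>T. T \<in> ktilings k n \<Longrightarrow> pmf (kshuffle b c t k n) T = ktiling_weight b c t k n T / Z"
    by auto
  have c': "c i > 0" and b': "b i > 0" if "i \<in> {1..Suc n}" for i
    using c[of i] b[of i] that Suc.prems by auto
  let ?K = "\<lambda>T. fill_colors b c t k (Suc n) k (\<lambda>a\<in>{1..k}. slide_destroy n (T a))"
  have "set_pmf (kshuffle b c t k (Suc n)) \<subseteq> ktilings k (Suc n)"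
    using supp set_fill_colors by fastforce
  moreover have "pmf (kshuffle b c t k (Suc n)) T' =
      ktiling_weight b c t k (Suc n) T' / (Z * partition_ratio b c t k n)" if T': "T' \<in> ktilings k (Suc n)" for T'
  proof -
    have "pmf (kshuffle b c t k (Suc n)) T' = (\<integral>T. pmf (?K T) T' \<partial>measure_pmf (kshuffle b c t k n))"
      by (simp add: pmf_bind)
    also have "\<dots> = (\<Sum>T\<in>ktilings k n. pmf (?K T) T' * pmf (kshuffle b c t k n) T)"
      by (rule integral_measure_pmf_real) (use finite_ktilings supp in auto)
    also have "\<dots> = (\<Sum>T\<in>ktilings k n. ktiling_weight b c t k n T * pmf (?K T) T') / Z"
      unfolding sum_divide_distrib by (intro sum.cong refl) (simp add: pmf mult.commute)
    also have "\<dots> = ktiling_weight b c t k (Suc n) T' / (Z * partition_ratio b c t k n)"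
    proof -
      have "(\<Sum>T\<in>ktilings k n. ktiling_weight b c t k n T * pmf (?K T) T') =
          ktiling_weight b c t k (Suc n) T' / partition_ratio b c t k n"
        by (rule weight_step; fact)
      then show ?thesis by simp
    qed
    finally show ?thesis .
  qed
  moreover have "Z * partition_ratio b c t k n > 0"
    using Z partition_ratio_pos[of n c b t k] c' b' t by simp
  ultimately show ?case by blast
qed

theorem theorem4p1:
  fixes k N :: nat and b c :: "nat \<Rightarrow> real" and t :: real
  assumes "k \<ge> 1"
    and "\<And>i. i \<in> {1..N} \<Longrightarrow> c i > 0"
    and "\<And>i. i \<in> {1..N} \<Longrightarrow> b i > 0"
    and "t \<ge> 0"
  shows "set_pmf (kshuffle b c t k N) \<subseteq> ktilings k N \<and>
    (\<Sum>T'\<in>ktilings k N. ktiling_weight b c t k N T') > 0 \<and>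
    (\<forall>T\<in>ktilings k N. pmf (kshuffle b c t k N) T =
       ktiling_weight b c t k N T / (\<Sum>T'\<in>ktilings k N. ktiling_weight b c t k N T'))"
proof -
  obtain Z where supp: "set_pmf (kshuffle b c t k N) \<subseteq> ktilings k N" and Z: "Z > 0"
    and pmf: "\<And>T. T \<in> ktilings k N \<Longrightarrow> pmf (kshuffle b c t k N) T = ktiling_weight b c t k N T / Z"
    using kshuffle_distribution[of N c b t N k] assms by auto
  have "1 = (\<Sum>T\<in>ktilings k N. pmf (kshuffle b c t k N) T)"
    using sum_pmf_eq_1[OF finite_ktilings supp] by simp
  also have "\<dots> = (\<Sum>T\<in>ktilings k N. ktiling_weight b c t k N T) / Z"
    unfolding sum_divide_distrib by (intro sum.cong refl pmf)
  finally have "(\<Sum>T\<in>ktilings k N. ktiling_weight b c t k N T) = Z"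
    using Z by (simp add: field_simps)
  with supp Z pmf show ?thesis by simp
qed

end
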